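(* There exist absolute constants $K,C>0$ such that the following holds. Let $p\in(0,1)$, let $n,d$ be integers with $1\le d\le K\sqrt{np(1-p)/\log[np(1-p)]}$, and let $k_1,\dots,k_{d+1}\in\{0,\dots,n\}$ be an $(\eta,M)$-system (with respect to $p$ and $n$) with $M\le\sqrt{np(1-p)}/(9d)$. Put $s=\sqrt{3\log[np(1-p)]}$, and for an integer $k$ write $\sigma(k)=\frac{k-np}{\sqrt{np(1-p)}}$. Then there exist real constants $\gamma_{k,i}$, for $1\le i\le d+1$ and for those integers $0\le k\le n$ with $|\sigma(k)|\le s$, satisfying $$|\gamma_{k,i}|\le\left(C(1+|\sigma(k)|)\frac M\eta\right)^d,$$ such that the following holds for every real multilinear polynomial $f$ in $x_1,\dots,x_n$ of degree $d$ with $\|f\|_{\nu_{k_i}}\le1$ for all $1\le i\le d+1$. Let $(\mathbf f_1,\dots,\mathbf f_{d+1})$ be the profile of $f$ with respect to $k_1,\dots,k_{d+1}$. Define a random variable $\mathbf f$ as follows: choose $k\sim\mathrm B(n,p)$ conditioned on $|\sigma(k)|\le s$, independently of the profile, and let $\mathbf f=\sum_{i=1}^{d+1}\gamma_{k,i}\mathbf f_i$. Then for every $1$-Lipschitz function $\varphi\colon\mathbb R\to\mathbb R$, $$\bigl|\mathbb E_{\mu_p}[\varphi(f)]-\mathbb E[\varphi(\mathbf f)]\bigr|\le\left(C\,\frac{d}{p(1-p)}\cdot\frac M\eta\right)^{Cd}\frac1{\sqrt[4]{np(1-p)}}.$$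
   Context: A polynomial is multilinear if all its monomials are squarefree. For $0\le k\le n$, $\nu_k$ is the uniform probability measure on $\{x\in\{0,1\}^n:\sum_i x_i=k\}$; $\mu_p$ is the product measure on $\{0,1\}^n$ with $\mu_p(x)=p^{\sum x_i}(1-p)^{\sum(1-x_i)}$; $\|f\|_\alpha=\sqrt{\mathbb E_\alpha[f^2]}$. $\mathrm B(n,p)$ is the binomial distribution. Fix $p\in(0,1)$ and $n$. Integers $0\le k_1,\dots,k_r\le n$ form an $(\eta,M)$-system, where $0<\eta\le1$ and $M\ge1$, if with $\sigma_i=\frac{k_i-np}{\sqrt{np(1-p)}}$ one has $|\sigma_i-\sigma_j|\ge\eta$ for all $i\ne j$ and $|\sigma_i|\le M$ for all $i$. Coupling of the slices: let $\boldsymbol\pi$ be a uniformly random permutation of $\{1,\dots,n\}$, and for $0\le s\le n$ let $\mathbf X(s)\in\{0,1\}^n$ be the point with $\mathbf X(s)_i=1$ if $i\in\boldsymbol\pi(\{1,\dots,s\})$ and $\mathbf X(s)_i=0$ otherwise. The profile of $f$ with respect to $k_1,\dots,k_{d+1}$ is the joint distribution of $(\mathbf f_1,\dots,\mathbf f_{d+1}):=(f(\mathbf X(k_1)),\dots,f(\mathbf X(k_{d+1})))$. A function $\varphi$ is $1$-Lipschitz if $|\varphi(x)-\varphi(y)|\le|x-y|$. *)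

theory Defs
  imports
    "HOL-Probability.Probability"
    "HOL-Library.Poly_Mapping"
begin

text \<open>
  A real polynomial is a finitely supported map from monomials to coefficients, and a monomial is
  a finitely supported map from variable indices to exponents.
\<close>

type_synonym monomial = "nat \<Rightarrow>\<^sub>0 nat"
type_synonym real_mpoly = "monomial \<Rightarrow>\<^sub>0 real"

definition monom_eval :: "monomial \<Rightarrow> (nat \<Rightarrow> real) \<Rightarrow> real" where
  "monom_eval m x = (\<Prod>i\<in>Poly_Mapping.keys m. x i ^ Poly_Mapping.lookup m i)"

definition poly_eval :: "real_mpoly \<Rightarrow> (nat \<Rightarrow> real) \<Rightarrow> real" where
  "poly_eval f x = (\<Sum>m\<in>Poly_Mapping.keys f. Poly_Mapping.lookup f m * monom_eval m x)"

definition monom_degree :: "monomial \<Rightarrow> nat" where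
  "monom_degree m = (\<Sum>i\<in>Poly_Mapping.keys m. Poly_Mapping.lookup m i)"

text \<open>With this convention the zero polynomial has total degree 0.\<close>

definition total_degree :: "real_mpoly \<Rightarrow> nat" where
  "total_degree f = Max (insert 0 (monom_degree ` Poly_Mapping.keys f))"

definition in_variables :: "nat set \<Rightarrow> real_mpoly \<Rightarrow> bool" where
  "in_variables V f \<longleftrightarrow> (\<forall>m\<in>Poly_Mapping.keys f. Poly_Mapping.keys m \<subseteq> V)"

definition squarefree_monom :: "monomial \<Rightarrow> bool" where
  "squarefree_monom m \<longleftrightarrow> (\<forall>i. Poly_Mapping.lookup m i \<le> 1)"

definition multilinear_poly :: "real_mpoly \<Rightarrow> bool" where
  "multilinear_poly f \<longleftrightarrow> (\<forall>m\<in>Poly_Mapping.keys f. squarefree_monom m)"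

text \<open>
  Points of the cube are functions on \<^typ>\<open>nat\<close> whose coordinates are indexed by \<open>{1..n}\<close>, extended
  by 0 outside that range so that each point has exactly one representative.
\<close>

definition cube :: "nat \<Rightarrow> (nat \<Rightarrow> real) set" where
  "cube n = PiE_dflt {1..n} 0 (\<lambda>_. {0, 1})"

definition slice :: "nat \<Rightarrow> nat \<Rightarrow> (nat \<Rightarrow> real) set" where
  "slice n k = {x \<in> cube n. (\<Sum>i\<in>{1..n}. x i) = real k}"

text \<open>Only meaningful for \<open>k \<le> n\<close>, since otherwise the slice is empty.\<close>

definition slice_pmf :: "nat \<Rightarrow> nat \<Rightarrow> (nat \<Rightarrow> real) pmf" where
  "slice_pmf n k = pmf_of_set (slice n k)"

definition cube_pmf :: "nat \<Rightarrow> real \<Rightarrow> (nat \<Rightarrow> real) pmf" where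
  "cube_pmf n p = Pi_pmf {1..n} 0 (\<lambda>_. map_pmf of_bool (bernoulli_pmf p))"

definition l2_norm_pmf :: "'a pmf \<Rightarrow> ('a \<Rightarrow> real) \<Rightarrow> real" where
  "l2_norm_pmf \<alpha> f = sqrt (measure_pmf.expectation \<alpha> (\<lambda>x. (f x)\<^sup>2))"

definition sigma_dev :: "real \<Rightarrow> nat \<Rightarrow> nat \<Rightarrow> real" where
  "sigma_dev p n k = (real k - real n * p) / sqrt (real n * p * (1 - p))"

definition eta_M_system ::
    "real \<Rightarrow> nat \<Rightarrow> real \<Rightarrow> real \<Rightarrow> nat \<Rightarrow> (nat \<Rightarrow> nat) \<Rightarrow> bool" where
  "eta_M_system p n \<eta> M r k \<longleftrightarrow>
     0 < \<eta> \<and> \<eta> \<le> 1 \<and> 1 \<le> M \<and>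
     (\<forall>i\<in>{1..r}. k i \<le> n) \<and>
     (\<forall>i\<in>{1..r}. \<forall>j\<in>{1..r}. i \<noteq> j \<longrightarrow> \<bar>sigma_dev p n (k i) - sigma_dev p n (k j)\<bar> \<ge> \<eta>) \<and>
     (\<forall>i\<in>{1..r}. \<bar>sigma_dev p n (k i)\<bar> \<le> M)"

definition slice_point :: "(nat \<Rightarrow> nat) \<Rightarrow> nat \<Rightarrow> nat \<Rightarrow> real" where
  "slice_point \<pi> s = (\<lambda>i. if i \<in> \<pi> ` {1..s} then 1 else 0)"

text \<open>
  The joint distribution, with the same permutation used for all the slices.  An \<open>r\<close>-tuple of reals
  is an extensional function on \<open>{1..r}\<close>.
\<close>

definition profile_pmf ::
    "nat \<Rightarrow> nat \<Rightarrow> (nat \<Rightarrow> nat) \<Rightarrow> ((nat \<Rightarrow> real) \<Rightarrow> real) \<Rightarrow> (nat \<Rightarrow> real) pmf" where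
  "profile_pmf n r k f =
     map_pmf (\<lambda>\<pi>. \<lambda>i\<in>{1..r}. f (slice_point \<pi> (k i))) (pmf_of_set {\<pi>. \<pi> permutes {1..n}})"

text \<open>
  The binomial distribution conditioned on \<open>\<bar>\<sigma>(k)\<bar> \<le> s\<close>; as usual for \<^const>\<open>cond_pmf\<close>, this is only
  meaningful when the conditioning event has positive probability.
\<close>

definition trunc_binomial_pmf :: "nat \<Rightarrow> real \<Rightarrow> real \<Rightarrow> nat pmf" where
  "trunc_binomial_pmf n p s = cond_pmf (binomial_pmf n p) {k. \<bar>sigma_dev p n k\<bar> \<le> s}"

definition mixture_pmf ::
    "nat \<Rightarrow> (nat \<Rightarrow> nat \<Rightarrow> real) \<Rightarrow> nat pmf \<Rightarrow> (nat \<Rightarrow> real) pmf \<Rightarrow> real pmf" where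
  "mixture_pmf r \<gamma> N P = map_pmf (\<lambda>(k, y). \<Sum>i\<in>{1..r}. \<gamma> k i * y i) (pair_pmf N P)"

end

theory Submission
  imports Defs "HOL-Computational_Algebra.Polynomial"
begin

text \<open>
Write \<open>V = n p (1 - p)\<close>, let \<open>W = sqrt V\<close>, and let \<open>X(k)\<close> be the point \<open>slice_point \<pi> k\<close> for a uniformly
random permutation \<open>\<pi>\<close>.  For \<open>k \<le> m\<close> the point \<open>X(k)\<close> is a uniformly random subset of size \<open>k\<close> of
\<open>X(m)\<close>.  Hence the conditional expectation of a monomial \<open>x_T\<close> at \<open>X(k)\<close> given \<open>X(m)\<close> is
\<open>(k)_t / (m)_t\<close> times \<open>x_T\<close> at \<open>X(m)\<close>, where \<open>t = |T|\<close> and \<open>(a)_t\<close> is the falling factorial.  So for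
a polynomial \<open>f\<close> of degree at most \<open>d\<close>, and with \<open>m\<close> fixed, the conditional expectation \<open>G(k)\<close> of
\<open>f(X(k))\<close> given \<open>X(m)\<close> is a polynomial of degree at most \<open>d\<close> in \<open>k\<close>.  Lagrange interpolation at the
nodes \<open>k_1, ..., k_{d+1}\<close> therefore expresses \<open>G(l)\<close> through the \<open>G(k_i)\<close> without any error, and the
Lagrange coefficients are the constants \<open>\<gamma>_{l,i}\<close>.

The interpolation error comes only from replacing \<open>f(X(k))\<close> by \<open>G(k)\<close>.  Its mean square is
\<open>E[f(X(k))^2] - E[G(k)^2]\<close>.  The walk that goes from slice \<open>k\<close> up to slice \<open>m\<close> and back preserves
the degree, and modulo lower degree it multiplies polynomials of degree \<open>j\<close> by
\<open>(k)_j (n-m)_j / ((m)_j (n-k)_j)\<close>.  Splitting off orthogonal complements degree by degree gives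
\<open>E[G(k)^2] \<ge> eigenvalue * E[f(X(k))^2]\<close> with the eigenvalue for \<open>j = d\<close> (lemma \<open>down_norm_lower\<close>), and
for slices not too far from \<open>n p\<close> this eigenvalue differs from 1 by at most
\<open>2 d (\<sigma>(m) - \<sigma>(k)) / W\<close>.  The square root of this
quantity is the source of the factor \<open>V^(-1/4)\<close> (lemma \<open>interpolation_error\<close>).

The argument needs the norm of \<open>f\<close> on all slices.  On slices with \<open>|\<sigma>(l)| \<le> 1\<close> the interpolation
formula bounds \<open>G(l)\<close> by the given norms, and an eigenvalue at least \<open>5/9\<close> transfers the bound from
\<open>G(l)\<close> to \<open>f\<close>.  The squared norm of \<open>f\<close> on slice \<open>l\<close> is a polynomial of degree at most \<open>2 d\<close> in \<open>l\<close>, so a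
second Lagrange interpolation, from \<open>2 d + 1\<close> equally spaced central slices, extends the bound to all
slices with growth \<open>(1 + |\<sigma>(l)|)^d\<close> (lemma \<open>norm_bound\<close>).

Finally, the cube with the product measure is the binomial mixture of the slices.  Averaging the
errors over \<open>l\<close> needs only the moments of \<open>1 + |\<sigma>(l)|\<close>, which are bounded through the moment
generating function; the same function shows that the truncation at \<open>sqrt (3 ln V)\<close> costs
\<open>O(V^(-1/4))\<close>.
\<close>

section \<open>Joint moments of two coupled slices\<close>

text \<open>
The falling factorial \<open>a (a - 1) ... (a - j + 1)\<close> at real arguments, so that it is a polynomial in \<open>a\<close>.
\<close>

definition ffact :: "real \<Rightarrow> nat \<Rightarrow> real" where
  "ffact a j = (\<Prod>i<j. a - real i)"

lemma ffact_0 [simp]: "ffact a 0 = 1"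
  by (simp add: ffact_def)

lemma ffact_Suc: "ffact a (Suc j) = ffact a j * (a - real j)"
  by (simp add: ffact_def)

definition mon :: "nat set \<Rightarrow> (nat \<Rightarrow> real) \<Rightarrow> real" where
  "mon T x = (\<Prod>i\<in>T. x i)"

definition comon :: "nat set \<Rightarrow> (nat \<Rightarrow> real) \<Rightarrow> real" where
  "comon S x = (\<Prod>i\<in>S. 1 - x i)"

definition perm_avg :: "nat \<Rightarrow> ((nat \<Rightarrow> nat) \<Rightarrow> real) \<Rightarrow> real" where
  "perm_avg n h = (\<Sum>\<pi> | \<pi> permutes {1..n}. h \<pi>) / fact n"

lemma card_perms: "card {\<pi>. \<pi> permutes {1..n}} = fact n"
  by (rule card_permutations) auto

lemma finite_perms: "finite {\<pi>. \<pi> permutes {1..n::nat}}"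
  by (rule finite_permutations) auto

lemma perms_nonempty: "{\<pi>. \<pi> permutes {1..n::nat}} \<noteq> {}"
  using permutes_id by blast

lemma perm_avg_expectation:
  "measure_pmf.expectation (pmf_of_set {\<pi>. \<pi> permutes {1..n}}) h = perm_avg n h"
  by (subst integral_pmf_of_set)
     (use finite_perms perms_nonempty card_perms in \<open>auto simp: perm_avg_def\<close>)

lemma perm_avg_const [simp]: "perm_avg n (\<lambda>_. a) = a"
  using card_perms[of n] by (simp add: perm_avg_def del: One_nat_def)

lemma perm_avg_add: "perm_avg n (\<lambda>\<pi>. f \<pi> + g \<pi>) = perm_avg n f + perm_avg n g"
  by (simp add: perm_avg_def sum.distrib add_divide_distrib)

lemma perm_avg_diff: "perm_avg n (\<lambda>\<pi>. f \<pi> - g \<pi>) = perm_avg n f - perm_avg n g"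
  by (simp add: perm_avg_def sum_subtractf diff_divide_distrib)

lemma perm_avg_cmult: "perm_avg n (\<lambda>\<pi>. a * f \<pi>) = a * perm_avg n f"
  by (simp add: perm_avg_def sum_distrib_left)

lemma perm_avg_sum: "perm_avg n (\<lambda>\<pi>. \<Sum>i\<in>I. f i \<pi>) = (\<Sum>i\<in>I. perm_avg n (f i))"
  unfolding perm_avg_def by (subst sum.swap) (simp add: sum_divide_distrib)

lemma perm_avg_mono:
  "(\<And>\<pi>. \<pi> permutes {1..n} \<Longrightarrow> f \<pi> \<le> g \<pi>) \<Longrightarrow> perm_avg n f \<le> perm_avg n g"
  unfolding perm_avg_def by (intro divide_right_mono sum_mono) auto

lemma perm_avg_cong:
  "(\<And>\<pi>. \<pi> permutes {1..n} \<Longrightarrow> f \<pi> = g \<pi>) \<Longrightarrow> perm_avg n f = perm_avg n g"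
  unfolding perm_avg_def by (intro arg_cong2[where f = "(/)"] sum.cong) auto

lemma perm_avg_nonneg:
  "(\<And>\<pi>. \<pi> permutes {1..n} \<Longrightarrow> f \<pi> \<ge> 0) \<Longrightarrow> perm_avg n f \<ge> 0"
  unfolding perm_avg_def by (intro divide_nonneg_nonneg sum_nonneg) auto

lemma perm_avg_abs: "\<bar>perm_avg n f\<bar> \<le> perm_avg n (\<lambda>\<pi>. \<bar>f \<pi>\<bar>)"
  unfolding perm_avg_def by (simp add: divide_right_mono)

lemma perm_avg_abs_le_sqrt: "perm_avg n (\<lambda>\<pi>. \<bar>f \<pi>\<bar>) \<le> sqrt (perm_avg n (\<lambda>\<pi>. (f \<pi>)\<^sup>2))"
proof -
  let ?a = "perm_avg n (\<lambda>\<pi>. \<bar>f \<pi>\<bar>)"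
  have "0 \<le> perm_avg n (\<lambda>\<pi>. (\<bar>f \<pi>\<bar> - ?a)\<^sup>2)"
    by (rule perm_avg_nonneg) simp
  also have "(\<lambda>\<pi>. (\<bar>f \<pi>\<bar> - ?a)\<^sup>2) = (\<lambda>\<pi>. ((f \<pi>)\<^sup>2 - (2 * ?a) * \<bar>f \<pi>\<bar>) + ?a\<^sup>2)"
    by (simp add: power2_diff algebra_simps)
  also have "perm_avg n \<dots> = perm_avg n (\<lambda>\<pi>. (f \<pi>)\<^sup>2) - 2 * ?a * ?a + ?a\<^sup>2"
    by (simp only: perm_avg_add perm_avg_diff perm_avg_cmult perm_avg_const)
  finally have "?a\<^sup>2 \<le> perm_avg n (\<lambda>\<pi>. (f \<pi>)\<^sup>2)"
    by (simp add: power2_eq_square)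
  thus ?thesis by (rule real_le_rsqrt)
qed

lemma perm_avg_compose_left:
  "\<tau> permutes {1..n} \<Longrightarrow> perm_avg n (\<lambda>\<pi>. f (\<tau> \<circ> \<pi>)) = perm_avg n f"
  unfolding perm_avg_def using setum_permutations_compose_left[of \<tau> "{1..n}" f] by simp

lemma slice_point_compose:
  assumes "\<tau> permutes {1..n}"
  shows "slice_point (\<tau> \<circ> \<pi>) k (\<tau> i) = slice_point \<pi> k i"
  using permutes_inj[OF assms] by (auto simp: slice_point_def inj_def)

lemma slice_point_01: "slice_point \<pi> k i = 0 \<or> slice_point \<pi> k i = 1"
  by (simp add: slice_point_def)

lemma slice_point_mono:
  "k \<le> m \<Longrightarrow> slice_point \<pi> m i = 0 \<Longrightarrow> slice_point \<pi> k i = 0"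
  by (auto simp: slice_point_def split: if_splits)

lemma slice_point_sum:
  assumes "\<pi> permutes {1..n}" "k \<le> n"
  shows "(\<Sum>i\<in>{1..n}. slice_point \<pi> k i) = real k"
proof -
  have sub: "\<pi> ` {1..k} \<subseteq> {1..n}"
    using permutes_image[OF assms(1)] assms(2) by (metis image_mono atLeastatMost_subset_iff order_refl)
  have "(\<Sum>i\<in>{1..n}. slice_point \<pi> k i) = (\<Sum>i\<in>\<pi> ` {1..k}. 1)"
    unfolding slice_point_def using sub by (subst sum.inter_restrict[symmetric]) (auto simp: Int_absorb1)
  also have "\<dots> = real (card (\<pi> ` {1..k}))" by simp
  also have "card (\<pi> ` {1..k}) = k"
    using permutes_inj[OF assms(1)] by (subst card_image) (auto simp: inj_on_def inj_def)
  finally show ?thesis .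
qed

definition joint_moment :: "nat \<Rightarrow> nat \<Rightarrow> nat \<Rightarrow> nat set \<Rightarrow> nat set \<Rightarrow> real" where
  "joint_moment n k m T S = perm_avg n (\<lambda>\<pi>. mon T (slice_point \<pi> k) * comon S (slice_point \<pi> m))"

text \<open>
Exchangeability: the uniform measure on permutations is invariant under relabelling the points.
\<close>

lemma joint_moment_image:
  assumes "\<tau> permutes {1..n}"
  shows "joint_moment n k m (\<tau> ` T) (\<tau> ` S) = joint_moment n k m T S"
proof -
  have inj: "inj_on \<tau> A" for A using permutes_inj_on[OF assms] .
  have "joint_moment n k m (\<tau> ` T) (\<tau> ` S) = perm_avg n (\<lambda>\<pi>. mon (\<tau> ` T) (slice_point (\<tau> \<circ> \<pi>) k) * comon (\<tau> ` S) (slice_point (\<tau> \<circ> \<pi>) m))"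
    unfolding joint_moment_def by (rule perm_avg_compose_left[OF assms, symmetric])
  also have "\<dots> = joint_moment n k m T S"
    unfolding joint_moment_def mon_def comon_def
    by (subst (1 2) prod.reindex[OF inj]) (simp only: o_def slice_point_compose[OF assms, unfolded o_def])
  finally show ?thesis .
qed

lemma joint_moment_swap:
  assumes "i \<in> {1..n} - T - S" "j \<in> {1..n} - T - S"
  shows "joint_moment n k m (insert i T) S = joint_moment n k m (insert j T) S"
    and "joint_moment n k m T (insert i S) = joint_moment n k m T (insert j S)"
proof -
  have p: "Transposition.transpose i j permutes {1..n}"
    using assms by (intro permutes_swap_id) auto
  have T: "Transposition.transpose i j ` T = T" and S: "Transposition.transpose i j ` S = S"
    using assms by auto
  show "joint_moment n k m (insert i T) S = joint_moment n k m (insert j T) S"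
    using joint_moment_image[OF p, of k m "insert i T" S] T S by simp
  show "joint_moment n k m T (insert i S) = joint_moment n k m T (insert j S)"
    using joint_moment_image[OF p, of k m T "insert i S"] T S by simp
qed

text \<open>
By exchangeability all the indices \<open>i\<close> outside \<open>T\<close> and \<open>S\<close> contribute equally, so the moment with one
more factor is an average over \<open>i\<close>.  On the support of the monomials, the coordinates outside \<open>T\<close> and
\<open>S\<close> have a known sum, because the total number of ones is fixed on a slice.  This gives a recursion
that determines all joint moments.
\<close>

lemma joint_moment_insert:
  assumes "T \<subseteq> {1..n}" "S \<subseteq> {1..n}" "T \<inter> S = {}" "k \<le> m" "m \<le> n" "i \<in> {1..n} - T - S"
  shows "real (n - card T - card S) * joint_moment n k m (insert i T) S = (real k - real (card T)) * joint_moment n k m T S"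
    and "real (n - card T - card S) * joint_moment n k m T (insert i S) = (real (n - m) - real (card S)) * joint_moment n k m T S"
proof -
  let ?W = "{1..n} - T - S"
  have fin: "finite T" "finite S" using finite_subset[OF assms(1)] finite_subset[OF assms(2)] by auto
  have cW: "card ?W = n - card T - card S"
  proof -
    have "card ({1..n} - (T \<union> S)) = card {1..n} - card (T \<union> S)"
      using assms fin by (intro card_Diff_subset) auto
    also have "card (T \<union> S) = card T + card S"
      using assms fin by (intro card_Un_disjoint) auto
    finally show ?thesis by (simp add: Diff_Un Int_Diff set_diff_eq conj_ac)
  qed
  have split: "(\<Sum>i\<in>{1..n}. g i) = (\<Sum>i\<in>?W. g i) + (\<Sum>i\<in>T. g i) + (\<Sum>i\<in>S. g i)" for g :: "nat \<Rightarrow> real"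
  proof -
    have "{1..n} = (?W \<union> T) \<union> S" using assms by auto
    hence "(\<Sum>i\<in>{1..n}. g i) = (\<Sum>i\<in>(?W \<union> T) \<union> S. g i)" by simp
    also have "\<dots> = (\<Sum>i\<in>?W \<union> T. g i) + (\<Sum>i\<in>S. g i)"
      using assms fin by (intro sum.union_disjoint) auto
    also have "(\<Sum>i\<in>?W \<union> T. g i) = (\<Sum>i\<in>?W. g i) + (\<Sum>i\<in>T. g i)"
      using assms fin by (intro sum.union_disjoint) auto
    finally show ?thesis .
  qed
  \<comment> \<open>Where the product is nonzero, \<open>X(k)\<close> is 1 on \<open>T\<close> and \<open>X(m)\<close> is 0 on \<open>S\<close>; by monotonicity the same holds with \<open>k\<close> and \<open>m\<close> exchanged.\<close>
  have pt: "(\<Sum>j\<in>?W. slice_point \<pi> k j) = real k - real (card T) \<and> (\<Sum>j\<in>?W. 1 - slice_point \<pi> m j) = real (n - m) - real (card S)"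
    if \<pi>: "\<pi> permutes {1..n}" and nz: "mon T (slice_point \<pi> k) * comon S (slice_point \<pi> m) \<noteq> 0" for \<pi>
  proof -
    have T1: "slice_point \<pi> k j = 1" if "j \<in> T" for j
      using nz that fin slice_point_01[of \<pi> k j] by (auto simp: mon_def)
    have S0: "slice_point \<pi> m j = 0" if "j \<in> S" for j
      using nz that fin slice_point_01[of \<pi> m j] by (auto simp: comon_def)
    have S0': "slice_point \<pi> k j = 0" if "j \<in> S" for j
      using S0[OF that] slice_point_mono assms(4) by blast
    have T1': "slice_point \<pi> m j = 1" if "j \<in> T" for j
      using T1[OF that] slice_point_mono[OF assms(4), of \<pi> j] slice_point_01[of \<pi> m j] by auto
    have "(\<Sum>j\<in>{1..n}. 1 - slice_point \<pi> m j) = real (n - m)"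
      using slice_point_sum[OF \<pi> assms(5)] assms(5) by (simp add: sum_subtractf of_nat_diff)
    moreover have "(\<Sum>j\<in>{1..n}. slice_point \<pi> k j) = real k"
      using slice_point_sum[OF \<pi>, of k] assms by simp
    ultimately show ?thesis
      using split[of "\<lambda>j. 1 - slice_point \<pi> m j"] split[of "slice_point \<pi> k"] T1 S0 T1' S0' by simp
  qed
  have "real (n - card T - card S) * joint_moment n k m (insert i T) S = (\<Sum>j\<in>?W. joint_moment n k m (insert i T) S)"
    by (simp only: sum_constant cW)
  also have "\<dots> = (\<Sum>j\<in>?W. joint_moment n k m (insert j T) S)"
    by (intro sum.cong refl joint_moment_swap) (use assms in auto)
  also have "\<dots> = perm_avg n (\<lambda>\<pi>. \<Sum>j\<in>?W. mon (insert j T) (slice_point \<pi> k) * comon S (slice_point \<pi> m))"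
    by (simp add: joint_moment_def perm_avg_sum)
  also have "\<dots> = perm_avg n (\<lambda>\<pi>. (real k - real (card T)) * (mon T (slice_point \<pi> k) * comon S (slice_point \<pi> m)))"
  proof (rule perm_avg_cong)
    fix \<pi> assume \<pi>: "\<pi> permutes {1..n}"
    have "(\<Sum>j\<in>?W. mon (insert j T) (slice_point \<pi> k) * comon S (slice_point \<pi> m))
        = (\<Sum>j\<in>?W. slice_point \<pi> k j) * (mon T (slice_point \<pi> k) * comon S (slice_point \<pi> m))"
      unfolding sum_distrib_right by (intro sum.cong) (use fin in \<open>auto simp: mon_def\<close>)
    also have "\<dots> = (real k - real (card T)) * (mon T (slice_point \<pi> k) * comon S (slice_point \<pi> m))"
      using pt[OF \<pi>] by (cases "mon T (slice_point \<pi> k) * comon S (slice_point \<pi> m) = 0") simp_all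
    finally show "(\<Sum>j\<in>?W. mon (insert j T) (slice_point \<pi> k) * comon S (slice_point \<pi> m)) = \<dots>" .
  qed
  finally show "real (n - card T - card S) * joint_moment n k m (insert i T) S = (real k - real (card T)) * joint_moment n k m T S"
    by (simp add: perm_avg_cmult joint_moment_def)
  have "real (n - card T - card S) * joint_moment n k m T (insert i S) = (\<Sum>j\<in>?W. joint_moment n k m T (insert i S))"
    by (simp only: sum_constant cW)
  also have "\<dots> = (\<Sum>j\<in>?W. joint_moment n k m T (insert j S))"
    by (intro sum.cong refl joint_moment_swap) (use assms in auto)
  also have "\<dots> = perm_avg n (\<lambda>\<pi>. \<Sum>j\<in>?W. mon T (slice_point \<pi> k) * comon (insert j S) (slice_point \<pi> m))"
    by (simp add: joint_moment_def perm_avg_sum)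
  also have "\<dots> = perm_avg n (\<lambda>\<pi>. (real (n - m) - real (card S)) * (mon T (slice_point \<pi> k) * comon S (slice_point \<pi> m)))"
  proof (rule perm_avg_cong)
    fix \<pi> assume \<pi>: "\<pi> permutes {1..n}"
    have "(\<Sum>j\<in>?W. mon T (slice_point \<pi> k) * comon (insert j S) (slice_point \<pi> m))
        = (\<Sum>j\<in>?W. 1 - slice_point \<pi> m j) * (mon T (slice_point \<pi> k) * comon S (slice_point \<pi> m))"
      unfolding sum_distrib_right by (intro sum.cong) (use fin in \<open>auto simp: comon_def\<close>)
    also have "\<dots> = (real (n - m) - real (card S)) * (mon T (slice_point \<pi> k) * comon S (slice_point \<pi> m))"
      using pt[OF \<pi>] by (cases "mon T (slice_point \<pi> k) * comon S (slice_point \<pi> m) = 0") simp_all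
    finally show "(\<Sum>j\<in>?W. mon T (slice_point \<pi> k) * comon (insert j S) (slice_point \<pi> m)) = \<dots>" .
  qed
  finally show "real (n - card T - card S) * joint_moment n k m T (insert i S) = (real (n - m) - real (card S)) * joint_moment n k m T S"
    by (simp add: perm_avg_cmult joint_moment_def)
qed

lemma joint_moment_formula:
  assumes "T \<subseteq> {1..n}" "S \<subseteq> {1..n}" "T \<inter> S = {}" "k \<le> m" "m \<le> n"
  shows "joint_moment n k m T S = ffact k (card T) * ffact (n - m) (card S) / ffact n (card T + card S)"
proof -
  have fin: "finite T" "finite S" using finite_subset[OF assms(1)] finite_subset[OF assms(2)] by auto
  have base: "joint_moment n k m {} S = ffact (n - m) (card S) / ffact n (card S)"
    using fin(2) assms(2)
  proof (induction S rule: finite_induct)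
    case empty
    show ?case by (simp add: joint_moment_def mon_def comon_def)
  next
    case (insert i S)
    have "card (insert i S) \<le> card {1..n}" using insert by (intro card_mono) auto
    hence c: "card S < n" using insert by simp
    have "real (n - card S) * joint_moment n k m {} (insert i S) = (real (n - m) - real (card S)) * joint_moment n k m {} S"
      using joint_moment_insert(2)[of "{}" n S k m i] insert assms by auto
    hence "joint_moment n k m {} (insert i S) = (real (n - m) - real (card S)) * joint_moment n k m {} S / (real n - real (card S))"
      using c by (simp add: field_simps of_nat_diff)
    thus ?case using insert by (simp add: ffact_Suc)
  qed
  show ?thesis
    using fin(1) assms(1,3)
  proof (induction T rule: finite_induct)
    case empty
    show ?case using base by simp
  next
    case (insert i T)
    have "card (insert i T \<union> S) \<le> card {1..n}" using insert assms by (intro card_mono) auto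
    hence c: "card T + card S < n" using insert fin by (simp add: card_Un_disjoint)
    have "real (n - card T - card S) * joint_moment n k m (insert i T) S = (real k - real (card T)) * joint_moment n k m T S"
      using joint_moment_insert(1)[of T n S k m i] insert assms by auto
    hence "joint_moment n k m (insert i T) S = (real k - real (card T)) * joint_moment n k m T S / (real n - real (card T + card S))"
      using c by (simp add: field_simps of_nat_diff)
    thus ?case using insert by (simp add: ffact_Suc)
  qed
qed

lemma joint_moment_not_disjoint:
  assumes "finite T" "finite S" "T \<inter> S \<noteq> {}" "k \<le> m"
  shows "joint_moment n k m T S = 0"
proof -
  obtain i where i: "i \<in> T" "i \<in> S" using assms by auto
  have "mon T (slice_point \<pi> k) * comon S (slice_point \<pi> m) = 0" for \<pi>
  proof (cases "slice_point \<pi> m i = 0")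
    case True
    thus ?thesis using i assms(1) slice_point_mono[OF assms(4) True] by (auto simp: mon_def)
  next
    case False
    thus ?thesis using i assms(2) slice_point_01[of \<pi> m i] by (auto simp: comon_def)
  qed
  thus ?thesis unfolding joint_moment_def by (simp only: perm_avg_const)
qed

lemma ffact_nat_eq_0_iff: "ffact (real a) j = 0 \<longleftrightarrow> a < j"
  by (auto simp: ffact_def)

text \<open>
Two instances of the formula for the moments differ only by a factor that depends on \<open>|T|\<close>, which is
the probability that a fixed \<open>T\<close> inside \<open>X(m)\<close> also lies inside \<open>X(k)\<close>.  This is the adjointness of
conditioning on \<open>X(m)\<close>, tested against the products of the \<open>1 - x i\<close>.
\<close>

lemma joint_moment_down:
  assumes "T \<subseteq> {1..n}" "S \<subseteq> {1..n}" "k \<le> m" "m \<le> n"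
  shows "joint_moment n k m T S = ffact k (card T) / ffact m (card T) * joint_moment n m m T S"
proof (cases "T \<inter> S = {}")
  case True
  have "ffact (real m) (card T) = 0 \<Longrightarrow> ffact (real k) (card T) = 0"
    using assms(3) by (simp add: ffact_nat_eq_0_iff)
  thus ?thesis using True assms by (simp add: joint_moment_formula)
next
  case False
  have "finite T" "finite S" using finite_subset[OF assms(1)] finite_subset[OF assms(2)] by auto
  thus ?thesis using False assms joint_moment_not_disjoint by simp
qed

text \<open>
The mirror image: conditioning on the smaller slice is diagonal in the products of the \<open>1 - x i\<close>.
\<close>

lemma joint_moment_up:
  assumes "T \<subseteq> {1..n}" "S \<subseteq> {1..n}" "k \<le> m" "m \<le> n"
  shows "joint_moment n k m T S = ffact (n - m) (card S) / ffact (n - k) (card S) * joint_moment n k k T S"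
proof (cases "T \<inter> S = {}")
  case True
  have "ffact (real (n - k)) (card S) = 0 \<Longrightarrow> ffact (real (n - m)) (card S) = 0"
    using assms(3) by (simp only: ffact_nat_eq_0_iff)
  thus ?thesis using True assms by (auto simp: joint_moment_formula simp del: of_nat_diff)
next
  case False
  have "finite T" "finite S" using finite_subset[OF assms(1)] finite_subset[OF assms(2)] by auto
  thus ?thesis using False assms joint_moment_not_disjoint by simp
qed

section \<open>Multilinear polynomials of bounded degree\<close>

definition mlpoly :: "nat \<Rightarrow> (nat set \<Rightarrow> real) \<Rightarrow> (nat \<Rightarrow> real) \<Rightarrow> real" where
  "mlpoly n c x = (\<Sum>T\<in>Pow {1..n}. c T * mon T x)"

text \<open>
A strict bound is used so that \<open>deg_less 0\<close> is the zero polynomial and induction on the degree can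
start there.
\<close>

definition deg_less :: "nat \<Rightarrow> (nat set \<Rightarrow> real) \<Rightarrow> bool" where
  "deg_less j c \<longleftrightarrow> (\<forall>T. c T \<noteq> 0 \<longrightarrow> card T < j)"

definition polys :: "nat \<Rightarrow> nat \<Rightarrow> ((nat \<Rightarrow> real) \<Rightarrow> real) set" where
  "polys n j = mlpoly n ` Collect (deg_less j)"

lemma polysI: "deg_less j c \<Longrightarrow> mlpoly n c \<in> polys n j"
  by (auto simp: polys_def)

lemma polysE:
  assumes "g \<in> polys n j"
  obtains c where "deg_less j c" "g = mlpoly n c"
  using assms by (auto simp: polys_def)

lemma polys_0: "g \<in> polys n 0 \<Longrightarrow> g x = 0"
  by (auto simp: polys_def deg_less_def mlpoly_def)

lemma polys_mono: "i \<le> j \<Longrightarrow> polys n i \<subseteq> polys n j"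
  unfolding polys_def deg_less_def by (intro image_mono) (auto intro: less_le_trans)

lemma zero_in_polys: "(\<lambda>x. 0) \<in> polys n j"
proof -
  have "mlpoly n (\<lambda>_. 0) \<in> polys n j"
    by (rule polysI) (simp add: deg_less_def)
  thus ?thesis by (simp add: mlpoly_def[abs_def])
qed

lemma add_in_polys:
  assumes "f \<in> polys n j" "g \<in> polys n j"
  shows "(\<lambda>x. f x + g x) \<in> polys n j"
proof -
  obtain a b where ab: "deg_less j a" "f = mlpoly n a" "deg_less j b" "g = mlpoly n b"
    using assms by (metis polysE)
  have "(\<lambda>x. f x + g x) = mlpoly n (\<lambda>T. a T + b T)"
    unfolding ab mlpoly_def by (simp add: sum.distrib distrib_right)
  moreover have "deg_less j (\<lambda>T. a T + b T)"
    using ab unfolding deg_less_def by (metis add.right_neutral)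
  ultimately show ?thesis by (simp add: polysI)
qed

lemma cmult_in_polys:
  assumes "f \<in> polys n j"
  shows "(\<lambda>x. t * f x) \<in> polys n j"
proof -
  obtain a where a: "deg_less j a" "f = mlpoly n a"
    using assms by (metis polysE)
  have "(\<lambda>x. t * f x) = mlpoly n (\<lambda>T. t * a T)"
    unfolding a mlpoly_def by (simp add: sum_distrib_left mult.assoc)
  moreover have "deg_less j (\<lambda>T. t * a T)"
    using a unfolding deg_less_def by auto
  ultimately show ?thesis by (simp add: polysI)
qed

lemma sum_in_polys:
  assumes "\<And>i. i \<in> I \<Longrightarrow> f i \<in> polys n j"
  shows "(\<lambda>x. \<Sum>i\<in>I. f i x) \<in> polys n j"
  using assms
  by (induction I rule: infinite_finite_induct) (auto intro: zero_in_polys add_in_polys)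

lemma mon_in_polys:
  assumes "T \<subseteq> {1..n}" "card T < j"
  shows "mon T \<in> polys n j"
proof -
  have "mon T = mlpoly n (\<lambda>U. if U = T then 1 else 0)"
  proof
    fix x
    have "mlpoly n (\<lambda>U. if U = T then 1 else 0) x = (\<Sum>U\<in>Pow {1..n}. if U = T then mon U x else 0)"
      unfolding mlpoly_def by (intro sum.cong) auto
    also have "\<dots> = mon T x" using assms by simp
    finally show "mon T x = mlpoly n (\<lambda>U. if U = T then 1 else 0) x" ..
  qed
  moreover have "deg_less j (\<lambda>U. if U = T then 1 else 0)"
    using assms by (auto simp: deg_less_def)
  ultimately show ?thesis by (simp add: polysI)
qed

text \<open>
Passing from a slice to a smaller one is diagonal in the monomials, and passing to a larger one is
diagonal in the products of the \<open>1 - x i\<close>.  The change of basis is triangular with respect to degree.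
\<close>

lemma mon_eq_sum_comon:
  assumes "finite T"
  shows "mon T x = (\<Sum>A\<in>Pow T. (-1) ^ card A * comon A x)"
proof -
  have "mon T x = (\<Prod>i\<in>T. - (1 - x i) + 1)" by (simp add: mon_def)
  also have "\<dots> = (\<Sum>A\<in>Pow T. (\<Prod>i\<in>A. - (1 - x i)) * (\<Prod>i\<in>T - A. 1))"
    by (rule prod_add[OF assms])
  also have "\<dots> = (\<Sum>A\<in>Pow T. (-1) ^ card A * comon A x)"
    unfolding comon_def by (subst prod_uminus) simp
  finally show ?thesis .
qed

lemma comon_eq_sum_mon:
  assumes "finite S"
  shows "comon S x = (\<Sum>A\<in>Pow S. (-1) ^ card A * mon A x)"
  using mon_eq_sum_comon[OF assms, of "\<lambda>i. 1 - x i"] by (simp add: mon_def comon_def)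

lemma comon_in_polys:
  assumes "S \<subseteq> {1..n}" "card S < j"
  shows "comon S \<in> polys n j"
proof -
  have fin: "finite S" by (rule finite_subset[OF assms(1)]) simp
  have "(\<lambda>x. \<Sum>A\<in>Pow S. (-1) ^ card A * mon A x) \<in> polys n j"
  proof (intro sum_in_polys cmult_in_polys mon_in_polys)
    fix A assume "A \<in> Pow S"
    thus "A \<subseteq> {1..n}" "card A < j"
      using assms card_mono[OF fin, of A] by auto
  qed
  thus ?thesis using comon_eq_sum_mon[OF fin] by presburger
qed

text \<open>
The mixed second moment of functions on two coupled slices.  For \<open>k = m\<close> it is the inner product of the space of
functions on slice \<open>k\<close>.
\<close>

definition cross :: "nat \<Rightarrow> nat \<Rightarrow> nat \<Rightarrow> ((nat \<Rightarrow> real) \<Rightarrow> real) \<Rightarrow> ((nat \<Rightarrow> real) \<Rightarrow> real) \<Rightarrow> real" where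
  "cross n k m f g = perm_avg n (\<lambda>\<pi>. f (slice_point \<pi> k) * g (slice_point \<pi> m))"

lemma cross_commute: "cross n k k f g = cross n k k g f"
  by (simp add: cross_def mult.commute)

lemma cross_add_left: "cross n k m (\<lambda>x. f x + g x) h = cross n k m f h + cross n k m g h"
  by (simp add: cross_def perm_avg_add distrib_right)

lemma cross_add_right: "cross n k m h (\<lambda>x. f x + g x) = cross n k m h f + cross n k m h g"
  by (simp add: cross_def perm_avg_add distrib_left)

lemma cross_diff_left: "cross n k m (\<lambda>x. f x - g x) h = cross n k m f h - cross n k m g h"
  by (simp add: cross_def perm_avg_diff left_diff_distrib)

lemma cross_cmult_left: "cross n k m (\<lambda>x. t * f x) h = t * cross n k m f h"
  by (simp add: cross_def perm_avg_cmult mult.assoc)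

lemma cross_cmult_right: "cross n k m h (\<lambda>x. t * f x) = t * cross n k m h f"
  by (simp add: cross_def perm_avg_cmult mult.left_commute)

lemma cross_sum_left: "cross n k m (\<lambda>x. \<Sum>i\<in>I. f i x) h = (\<Sum>i\<in>I. cross n k m (f i) h)"
  by (simp add: cross_def perm_avg_sum sum_distrib_right)

lemma cross_sum_right: "cross n k m h (\<lambda>x. \<Sum>i\<in>I. f i x) = (\<Sum>i\<in>I. cross n k m h (f i))"
  by (simp add: cross_def perm_avg_sum sum_distrib_left)

lemma cross_mlpoly_left: "cross n k m (mlpoly n c) g = (\<Sum>T\<in>Pow {1..n}. c T * cross n k m (mon T) g)"
  unfolding mlpoly_def by (simp add: cross_sum_left cross_cmult_left)

lemma cross_mlpoly_right: "cross n k m g (mlpoly n c) = (\<Sum>T\<in>Pow {1..n}. c T * cross n k m g (mon T))"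
  unfolding mlpoly_def by (simp add: cross_sum_right cross_cmult_right)

lemma cross_mon_right:
  assumes "T \<subseteq> {1..n}"
  shows "cross n k m f (mon T) = (\<Sum>A\<in>Pow T. (-1) ^ card A * cross n k m f (comon A))"
proof -
  have fin: "finite T" by (rule finite_subset[OF assms]) simp
  have "cross n k m f (mon T) = cross n k m f (\<lambda>x. \<Sum>A\<in>Pow T. (-1) ^ card A * comon A x)"
    using mon_eq_sum_comon[OF fin] by presburger
  thus ?thesis by (simp add: cross_sum_right cross_cmult_right)
qed

lemma cross_nonneg: "cross n k k f f \<ge> 0"
  unfolding cross_def by (intro perm_avg_nonneg) simp

section \<open>Conditional expectations along the chain of slices\<close>

text \<open>
The coefficients of the conditional expectation of a polynomial at \<open>X(k)\<close> given \<open>X(m)\<close>; lemma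
\<open>cross_down\<close> below characterises it by duality.
\<close>

definition down :: "nat \<Rightarrow> nat \<Rightarrow> (nat set \<Rightarrow> real) \<Rightarrow> nat set \<Rightarrow> real" where
  "down k m c T = ffact k (card T) / ffact m (card T) * c T"

lemma deg_less_down: "deg_less j c \<Longrightarrow> deg_less j (down k m c)"
  by (auto simp: deg_less_def down_def)

lemma cross_mon_down:
  assumes "T \<subseteq> {1..n}" "g \<in> polys n j" "k \<le> m" "m \<le> n"
  shows "cross n k m (mon T) g = ffact k (card T) / ffact m (card T) * cross n m m (mon T) g"
proof -
  obtain c where c: "g = mlpoly n c" using assms(2) polysE by blast
  have *: "cross n k m (mon T) (comon S) = ffact k (card T) / ffact m (card T) * cross n m m (mon T) (comon S)"
    if "S \<subseteq> {1..n}" for S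
    using joint_moment_down[OF assms(1) that assms(3,4)] by (simp add: cross_def joint_moment_def)
  have **: "cross n k m (mon T) (mon U) = ffact k (card T) / ffact m (card T) * cross n m m (mon T) (mon U)"
    if "U \<subseteq> {1..n}" for U
  proof -
    have "S \<subseteq> {1..n}" if "S \<in> Pow U" for S using that \<open>U \<subseteq> _\<close> by auto
    thus ?thesis
      unfolding cross_mon_right[OF that] sum_distrib_left
      by (intro sum.cong refl, subst *) auto
  qed
  show ?thesis unfolding c cross_mlpoly_right sum_distrib_left
    by (intro sum.cong refl, subst **) auto
qed

lemma cross_down:
  assumes "g \<in> polys n j" "k \<le> m" "m \<le> n"
  shows "cross n k m (mlpoly n c) g = cross n m m (mlpoly n (down k m c)) g"
  unfolding cross_mlpoly_left
  by (intro sum.cong refl, subst cross_mon_down[OF _ assms]) (auto simp: down_def)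

text \<open>
Expand the monomial in the products \<open>comon A\<close>, on each of which the operator acts as a scalar that
depends on \<open>|A|\<close>.  Subtracting the scalar of the top term \<open>A = T\<close> leaves only proper subsets of \<open>T\<close>,
hence a remainder \<open>g\<close> of lower degree.
\<close>

lemma cross_mon_up:
  assumes "T \<subseteq> {1..n}" "k \<le> m" "m \<le> n"
  obtains g where "g \<in> polys n (card T)"
    "\<And>f j. f \<in> polys n j \<Longrightarrow> cross n k m f (mon T) =
       ffact (n - m) (card T) / ffact (n - k) (card T) * cross n k k f (mon T) + cross n k k f g"
proof -
  \<comment> \<open>The operator multiplies \<open>comon A\<close> by \<open>q (card A)\<close>.\<close>
  define q where "q = (\<lambda>i. ffact (real (n - m)) i / ffact (real (n - k)) i)"
  define t where "t = card T"
  define g where "g = (\<lambda>x. \<Sum>A\<in>Pow T - {T}. ((-1) ^ card A * (q (card A) - q t)) * comon A x)"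
  have fin: "finite T" by (rule finite_subset[OF assms(1)]) simp
  have g: "g \<in> polys n (card T)"
    unfolding g_def
  proof (intro sum_in_polys cmult_in_polys comon_in_polys)
    fix A assume "A \<in> Pow T - {T}"
    thus "A \<subseteq> {1..n}" "card A < card T"
      using assms(1) psubset_card_mono[OF fin, of A] by auto
  qed
  have "cross n k m f (mon T) = q t * cross n k k f (mon T) + cross n k k f g"
    if f: "f \<in> polys n j" for f j
  proof -
    obtain c where c: "f = mlpoly n c" using f polysE by blast
    have *: "cross n k m f (comon S) = q (card S) * cross n k k f (comon S)"
      if S: "S \<subseteq> {1..n}" for S
    proof -
      have "cross n k m (mon U) (comon S) = q (card S) * cross n k k (mon U) (comon S)"
        if "U \<subseteq> {1..n}" for U
        using joint_moment_up[OF that S assms(2,3)] by (simp add: cross_def joint_moment_def q_def)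
      thus ?thesis unfolding c cross_mlpoly_left sum_distrib_left
        by (intro sum.cong refl) auto
    qed
    have sub: "S \<subseteq> {1..n}" if "S \<in> Pow T" for S using that assms(1) by auto
    have "cross n k m f (mon T) = (\<Sum>A\<in>Pow T. (-1) ^ card A * q (card A) * cross n k k f (comon A))"
      unfolding cross_mon_right[OF assms(1)]
      by (intro sum.cong refl) (simp add: *[OF sub] del: Pow_iff)
    also have "\<dots> = (\<Sum>A\<in>Pow T. q t * ((-1) ^ card A * cross n k k f (comon A))
         + ((-1) ^ card A * (q (card A) - q t)) * cross n k k f (comon A))"
      by (intro sum.cong refl) (simp add: algebra_simps)
    also have "\<dots> = q t * cross n k k f (mon T) + (\<Sum>A\<in>Pow T. ((-1) ^ card A * (q (card A) - q t)) * cross n k k f (comon A))"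
      unfolding cross_mon_right[OF assms(1)] by (simp add: sum.distrib sum_distrib_left)
    also have "(\<Sum>A\<in>Pow T. ((-1) ^ card A * (q (card A) - q t)) * cross n k k f (comon A))
       = (\<Sum>A\<in>Pow T - {T}. ((-1) ^ card A * (q (card A) - q t)) * cross n k k f (comon A))"
      using fin by (intro sum.mono_neutral_right) (auto simp: t_def)
    also have "\<dots> = cross n k k f g"
      unfolding g_def by (simp only: cross_sum_right cross_cmult_right)
    finally show ?thesis .
  qed
  thus ?thesis using that[OF g] by (simp add: q_def t_def)
qed

section \<open>Eigenvalues of the up-down walk and low-degree contraction\<close>

text \<open>
The eigenvalue in degree \<open>j\<close> of the walk from slice \<open>k\<close> up to slice \<open>m\<close> and back: the product of the
scalars of the two steps.
\<close>

definition eigenvalue :: "nat \<Rightarrow> nat \<Rightarrow> nat \<Rightarrow> nat \<Rightarrow> real" where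
  "eigenvalue n k m j = (ffact k j / ffact m j) * (ffact (n - m) j / ffact (n - k) j)"

text \<open>
The up-down walk is a scalar on polynomials of degree \<open>j\<close> modulo polynomials of lower degree.
\<close>

lemma cross_down_triangular:
  assumes "deg_less (Suc j) c" "k \<le> m" "m \<le> n"
  obtains g where "g \<in> polys n j"
    "\<And>f i. f \<in> polys n i \<Longrightarrow> cross n k m f (mlpoly n (down k m c)) =
       eigenvalue n k m j * cross n k k f (mlpoly n c) + cross n k k f g"
proof -
  define r where "r = (\<lambda>i. ffact (real k) i / ffact (real m) i)"
  define q where "q = (\<lambda>i. ffact (real (n - m)) i / ffact (real (n - k)) i)"
  have "\<forall>T\<in>Pow {1..n}. \<exists>g. g \<in> polys n (card T) \<and> (\<forall>f j. f \<in> polys n j \<longrightarrow>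
        cross n k m f (mon T) = q (card T) * cross n k k f (mon T) + cross n k k f g)"
    using cross_mon_up[OF _ assms(2,3)] unfolding q_def by (metis Pow_iff)
  then obtain G where G: "\<And>T. T \<in> Pow {1..n} \<Longrightarrow> G T \<in> polys n (card T)"
    "\<And>T f j. T \<in> Pow {1..n} \<Longrightarrow> f \<in> polys n j \<Longrightarrow>
        cross n k m f (mon T) = q (card T) * cross n k k f (mon T) + cross n k k f (G T)"
    by metis
  \<comment> \<open>The terms of top degree \<open>j\<close> vanish in the second summand, so \<open>g\<close> has degree below \<open>j\<close>.\<close>
  define g where "g = (\<lambda>x. \<Sum>T\<in>Pow {1..n}. c T * r (card T) * G T x + c T * (r (card T) * q (card T) - r j * q j) * mon T x)"
  have "g \<in> polys n j"
    unfolding g_def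
  proof (intro sum_in_polys add_in_polys)
    fix T assume T: "T \<in> Pow {1..n}"
    show "(\<lambda>x. c T * r (card T) * G T x) \<in> polys n j"
    proof (cases "c T = 0")
      case False
      hence "card T \<le> j" using assms(1) by (auto simp: deg_less_def)
      thus ?thesis using G(1)[OF T] polys_mono by (intro cmult_in_polys) blast
    qed (simp add: zero_in_polys)
    show "(\<lambda>x. c T * (r (card T) * q (card T) - r j * q j) * mon T x) \<in> polys n j"
    proof (cases "c T = 0 \<or> card T = j")
      case False
      hence "card T < j" using assms(1) by (auto simp: deg_less_def)
      thus ?thesis using T by (intro cmult_in_polys mon_in_polys) auto
    qed (auto simp: zero_in_polys)
  qed
  moreover have "cross n k m f (mlpoly n (down k m c)) =
       eigenvalue n k m j * cross n k k f (mlpoly n c) + cross n k k f g" if f: "f \<in> polys n i" for f i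
  proof -
    have "cross n k m f (mlpoly n (down k m c))
      = (\<Sum>T\<in>Pow {1..n}. r j * q j * (c T * cross n k k f (mon T))
          + (c T * r (card T) * cross n k k f (G T) + c T * (r (card T) * q (card T) - r j * q j) * cross n k k f (mon T)))"
      unfolding cross_mlpoly_right
      by (intro sum.cong refl, subst G(2)[OF _ f]) (auto simp: down_def r_def algebra_simps)
    also have "\<dots> = eigenvalue n k m j * cross n k k f (mlpoly n c) + cross n k k f g"
      unfolding g_def cross_mlpoly_right cross_sum_right cross_add_right cross_cmult_right sum.distrib
      by (simp add: sum_distrib_left eigenvalue_def q_def r_def)
    finally show ?thesis .
  qed
  ultimately show ?thesis by (rule that)
qed

text \<open>
Gram-Schmidt for the positive semidefinite form of one slice.  If the new vector is null modulo the old
ones then it vanishes on the slice, and \<open>t = 0\<close> is the right coefficient (which is also the value of the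
quotient with denominator 0).
\<close>

lemma projection_exists:
  fixes v :: "'b \<Rightarrow> (nat \<Rightarrow> real) \<Rightarrow> real"
  assumes "finite B"
  shows "\<exists>a. \<forall>b\<in>B. cross n k k (\<lambda>x. f x - (\<Sum>b'\<in>B. a b' * v b' x)) (v b) = 0"
  using assms
proof (induction B arbitrary: f rule: finite_induct)
  case (insert b B)
  obtain a0 where a0: "\<forall>b'\<in>B. cross n k k (\<lambda>x. f x - (\<Sum>b'\<in>B. a0 b' * v b' x)) (v b') = 0"
    using insert.IH by blast
  obtain b0 where b0: "\<forall>b'\<in>B. cross n k k (\<lambda>x. v b x - (\<Sum>b'\<in>B. b0 b' * v b' x)) (v b') = 0"
    using insert.IH by blast
  define f0 where "f0 = (\<lambda>x. f x - (\<Sum>b'\<in>B. a0 b' * v b' x))"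
  define w where "w = (\<lambda>x. v b x - (\<Sum>b'\<in>B. b0 b' * v b' x))"
  define t where "t = cross n k k f0 w / cross n k k w w"
  have tw: "cross n k k f0 w = t * cross n k k w w"
  proof (cases "cross n k k w w = 0")
    case True
    have "w (slice_point \<pi> k) = 0" if "\<pi> permutes {1..n}" for \<pi>
    proof -
      have "\<forall>\<pi>\<in>{\<pi>. \<pi> permutes {1..n}}. w (slice_point \<pi> k) * w (slice_point \<pi> k) = 0"
        using True finite_perms[of n] unfolding cross_def perm_avg_def
        by (subst (asm) divide_eq_0_iff, subst (asm) sum_nonneg_eq_0_iff) auto
      thus ?thesis using that by auto
    qed
    hence "cross n k k f0 w = perm_avg n (\<lambda>\<pi>. 0)"
      unfolding cross_def by (intro perm_avg_cong) simp
    thus ?thesis using True by simp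
  qed (simp add: t_def)
  define a where "a = (\<lambda>b'. if b' = b then t else a0 b' - t * b0 b')"
  have eq: "f x - (\<Sum>b'\<in>insert b B. a b' * v b' x) = f0 x - t * w x" for x
  proof -
    have "(\<Sum>b'\<in>B. a b' * v b' x) = (\<Sum>b'\<in>B. a0 b' * v b' x - t * (b0 b' * v b' x))"
      using insert.hyps by (intro sum.cong) (auto simp: a_def algebra_simps)
    thus ?thesis
      using insert.hyps unfolding f0_def w_def
      by (simp add: a_def sum_subtractf sum_distrib_left algebra_simps)
  qed
  have B0: "cross n k k (\<lambda>x. f0 x - t * w x) (v b') = 0" if "b' \<in> B" for b'
    using a0 b0 that unfolding f0_def[symmetric] w_def[symmetric]
    by (simp add: cross_diff_left cross_cmult_left)
  have "v b = (\<lambda>x. w x + (\<Sum>b'\<in>B. b0 b' * v b' x))" by (simp add: w_def)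
  hence "cross n k k (\<lambda>x. f0 x - t * w x) (v b)
      = cross n k k (\<lambda>x. f0 x - t * w x) w + (\<Sum>b'\<in>B. b0 b' * cross n k k (\<lambda>x. f0 x - t * w x) (v b'))"
    by (simp only: cross_add_right cross_sum_right cross_cmult_right)
  also have "\<dots> = 0"
    using B0 tw by (simp add: cross_diff_left cross_cmult_left)
  finally have "\<forall>b'\<in>insert b B. cross n k k (\<lambda>x. f x - (\<Sum>b'\<in>insert b B. a b' * v b' x)) (v b') = 0"
    unfolding eq using B0 by blast
  thus ?case by blast
qed simp

lemma polys_projection:
  obtains a where "deg_less j a" "\<And>g. g \<in> polys n j \<Longrightarrow> cross n k k (\<lambda>x. f x - mlpoly n a x) g = 0"
proof -
  let ?B = "{T \<in> Pow {1..n}. card T < j}"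
  obtain a where a: "\<forall>T\<in>?B. cross n k k (\<lambda>x. f x - (\<Sum>T\<in>?B. a T * mon T x)) (mon T) = 0"
    using projection_exists[of ?B n k f mon] by auto
  define a' where "a' = (\<lambda>T. if card T < j then a T else 0)"
  have eq: "(\<Sum>T\<in>?B. a T * mon T x) = mlpoly n a' x" for x
    unfolding mlpoly_def a'_def by (subst sum.inter_filter) (auto intro!: sum.cong)
  have "cross n k k (\<lambda>x. f x - mlpoly n a' x) g = 0" if g: "g \<in> polys n j" for g
  proof -
    obtain c where c: "deg_less j c" "g = mlpoly n c" using g polysE by blast
    show ?thesis
      unfolding c cross_mlpoly_right
    proof (intro sum.neutral ballI)
      fix T assume T: "T \<in> Pow {1..n}"
      show "c T * cross n k k (\<lambda>x. f x - mlpoly n a' x) (mon T) = 0"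
        using a[unfolded eq] c(1) T by (cases "c T = 0") (auto simp: deg_less_def)
    qed
  qed
  moreover have "deg_less j a'" by (auto simp: a'_def deg_less_def)
  ultimately show ?thesis using that by blast
qed

lemma eigenvalue_0 [simp]: "eigenvalue n k m 0 = 1"
  by (simp add: eigenvalue_def)

lemma eigenvalue_Suc:
  "eigenvalue n k m (Suc j) = eigenvalue n k m j * ((real k - real j) / (real m - real j) * ((real (n - m) - real j) / (real (n - k) - real j)))"
  by (simp add: eigenvalue_def ffact_Suc mult_ac)

lemma eigenvalue_factor_bounds:
  assumes "k \<le> m" "m \<le> n" "j < k" "j < n - m"
  defines "\<phi> \<equiv> (real k - real j) / (real m - real j) * ((real (n - m) - real j) / (real (n - k) - real j))"
  shows "0 \<le> \<phi>" "\<phi> \<le> 1"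
proof -
  have 1: "0 \<le> (real k - real j) / (real m - real j)" "(real k - real j) / (real m - real j) \<le> 1"
    using assms(1-4) by (auto simp: divide_simps)
  have 2: "0 \<le> (real (n - m) - real j) / (real (n - k) - real j)" "(real (n - m) - real j) / (real (n - k) - real j) \<le> 1"
    using assms(1-4) by (auto simp: divide_simps)
  show "0 \<le> \<phi>" unfolding \<phi>_def using 1 2 by (intro mult_nonneg_nonneg)
  show "\<phi> \<le> 1" unfolding \<phi>_def using 1 2 by (intro mult_le_one)
qed

lemma eigenvalue_bounds:
  assumes "k \<le> m" "m \<le> n" "j \<le> k" "j \<le> n - m"
  shows "0 \<le> eigenvalue n k m j \<and> eigenvalue n k m j \<le> 1"
  using assms(3,4)
proof (induction j)
  case (Suc j)
  note b = eigenvalue_factor_bounds[OF assms(1,2), of j]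
  have l: "0 \<le> eigenvalue n k m j" "eigenvalue n k m j \<le> 1" using Suc by auto
  show ?case unfolding eigenvalue_Suc
    using Suc.prems by (intro conjI mult_nonneg_nonneg[OF l(1)] mult_le_one[OF l(2)] b) auto
qed simp

lemma eigenvalue_antimono:
  assumes "k \<le> m" "m \<le> n" "Suc j \<le> k" "Suc j \<le> n - m"
  shows "eigenvalue n k m (Suc j) \<le> eigenvalue n k m j"
  unfolding eigenvalue_Suc using eigenvalue_factor_bounds[OF assms(1,2), of j] eigenvalue_bounds[OF assms(1,2), of j] assms
  by (intro mult_left_le) auto

text \<open>
Each factor of the eigenvalue is a product \<open>(1 - u) (1 - v)\<close> with \<open>u\<close> and \<open>v\<close> proportional to \<open>m - k\<close>, and
the deviations from 1 add up at most.
\<close>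

lemma one_minus_eigenvalue_le:
  assumes "k \<le> m" "m \<le> n" "d \<le> k" "d \<le> n - m"
    and "0 < a" "a \<le> real m - real d" "0 < b" "b \<le> real (n - k) - real d"
  shows "1 - eigenvalue n k m d \<le> real d * (real m - real k) * (1 / a + 1 / b)"
proof -
  define \<delta> where "\<delta> = (real m - real k) * (1 / a + 1 / b)"
  have "1 - eigenvalue n k m j \<le> real j * \<delta>" if "j \<le> d" for j
    using that
  proof (induction j)
    case (Suc j)
    define u where "u = (real m - real k) / (real m - real j)"
    define v where "v = (real m - real k) / (real (n - k) - real j)"
    have u: "(real k - real j) / (real m - real j) = 1 - u"
      using Suc assms by (simp add: u_def field_simps)
    have v: "(real (n - m) - real j) / (real (n - k) - real j) = 1 - v"
      using Suc assms by (simp add: v_def field_simps of_nat_diff)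
    have uv: "0 \<le> u" "0 \<le> v" using Suc assms by (auto simp: u_def v_def)
    have "u \<le> (real m - real k) / a" unfolding u_def
      using Suc assms by (intro divide_left_mono mult_pos_pos) auto
    moreover have "v \<le> (real m - real k) / b" unfolding v_def
      using Suc assms by (intro divide_left_mono mult_pos_pos) auto
    ultimately have uvd: "u + v \<le> \<delta>"
      unfolding \<delta>_def distrib_left by simp
    have l: "0 \<le> eigenvalue n k m j" "eigenvalue n k m j \<le> 1"
      using eigenvalue_bounds[OF assms(1,2), of j] Suc assms by auto
    have "eigenvalue n k m (Suc j) = eigenvalue n k m j * ((1 - u) * (1 - v))"
      unfolding eigenvalue_Suc u v ..
    moreover have "eigenvalue n k m j * (1 - (u + v)) \<le> eigenvalue n k m j * ((1 - u) * (1 - v))"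
      using l uv by (intro mult_left_mono) (auto simp: algebra_simps)
    moreover have "eigenvalue n k m j * (u + v) \<le> 1 * \<delta>"
      using l uv uvd by (intro mult_mono) auto
    ultimately show ?case using Suc by (simp add: algebra_simps)
  qed simp
  from this[of d] show ?thesis by (simp add: \<delta>_def algebra_simps)
qed

text \<open>
Induction on the degree: split off the part \<open>h\<close> that is orthogonal to lower degree.  By triangularity,
conditioning keeps \<open>h\<close> orthogonal to the lower-degree part and scales its squared norm by the eigenvalue;
the other part has a larger eigenvalue by induction.
\<close>

lemma down_norm_lower:
  assumes "deg_less (Suc j) c" "k \<le> m" "m \<le> n" "j \<le> k" "j \<le> n - m"
  shows "eigenvalue n k m j * cross n k k (mlpoly n c) (mlpoly n c)
       \<le> cross n m m (mlpoly n (down k m c)) (mlpoly n (down k m c))"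
  using assms(1,4,5)
proof (induction j arbitrary: c)
  case 0
  obtain g where g: "g \<in> polys n 0" "\<And>f i. f \<in> polys n i \<Longrightarrow> cross n k m f (mlpoly n (down k m c)) =
       eigenvalue n k m 0 * cross n k k f (mlpoly n c) + cross n k k f g"
    using cross_down_triangular[OF 0(1) assms(2,3)] by metis
  have "cross n k k f g = 0" for f
    using polys_0[OF g(1)] by (simp add: cross_def)
  thus ?case
    using g(2)[OF polysI[OF 0(1)]] cross_down[OF polysI[OF deg_less_down[OF 0(1)]] assms(2,3)] by simp
next
  case (Suc j)
  define N where "N = (\<lambda>c c'. cross n m m (mlpoly n (down k m c)) (mlpoly n (down k m c')))"
  obtain a where a: "deg_less (Suc j) a"
    "\<And>g. g \<in> polys n (Suc j) \<Longrightarrow> cross n k k (\<lambda>x. mlpoly n c x - mlpoly n a x) g = 0"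
    using polys_projection by metis
  define h where "h = (\<lambda>T. c T - a T)"
  have h_eq: "mlpoly n h = (\<lambda>x. mlpoly n c x - mlpoly n a x)"
    by (simp add: h_def mlpoly_def fun_eq_iff sum_subtractf left_diff_distrib)
  have c_eq: "mlpoly n c = (\<lambda>x. mlpoly n a x + mlpoly n h x)"
    by (simp add: h_eq)
  have orth: "cross n k k (mlpoly n h) g = 0" if "g \<in> polys n (Suc j)" for g
    using a(2)[OF that] by (simp add: h_eq)
  have degh: "deg_less (Suc (Suc j)) h"
    using Suc.prems(1) a(1) unfolding deg_less_def h_def
    by (metis diff_0_right less_SucI)
  have down_eq: "mlpoly n (down k m c) = (\<lambda>x. mlpoly n (down k m a) x + mlpoly n (down k m h) x)"
  proof
    fix x
    show "mlpoly n (down k m c) x = mlpoly n (down k m a) x + mlpoly n (down k m h) x"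
      unfolding mlpoly_def sum.distrib[symmetric]
    proof (intro sum.cong refl)
      fix T
      have "c T = a T + h T" by (simp add: h_def)
      thus "down k m c T * mon T x = down k m a T * mon T x + down k m h T * mon T x"
        unfolding down_def by (simp only: distrib_left distrib_right)
    qed
  qed
  have N_eq: "N b b' = cross n k m (mlpoly n b) (mlpoly n (down k m b'))" if "deg_less i b'" for b b' i
    unfolding N_def using cross_down[OF polysI[OF deg_less_down[OF that]] assms(2,3)] by simp
  obtain g where g: "g \<in> polys n (Suc j)" "\<And>f i. f \<in> polys n i \<Longrightarrow> cross n k m f (mlpoly n (down k m h)) =
       eigenvalue n k m (Suc j) * cross n k k f (mlpoly n h) + cross n k k f g"
    using cross_down_triangular[OF degh assms(2,3)] by metis
  obtain g' where g': "g' \<in> polys n j" "\<And>f i. f \<in> polys n i \<Longrightarrow> cross n k m f (mlpoly n (down k m a)) =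
       eigenvalue n k m j * cross n k k f (mlpoly n a) + cross n k k f g'"
    using cross_down_triangular[OF a(1) assms(2,3)] by metis
  have g'': "g' \<in> polys n (Suc j)" using g'(1) polys_mono[of j "Suc j" n] by auto
  have Nhh: "N h h = eigenvalue n k m (Suc j) * cross n k k (mlpoly n h) (mlpoly n h)"
    using N_eq[OF degh] g(2)[OF polysI[OF degh]] orth[OF g(1)] by simp
  have Nha: "N h a = 0"
    using N_eq[OF a(1)] g'(2)[OF polysI[OF degh]] orth[OF g''] orth[OF polysI[OF a(1)]] by simp
  have "cross n m m (mlpoly n (down k m c)) (mlpoly n (down k m c)) = N a a + N a h + N h a + N h h"
    unfolding down_eq N_def by (simp only: cross_add_left cross_add_right)
  also have "N a h = N h a" unfolding N_def by (rule cross_commute)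
  finally have 1: "cross n m m (mlpoly n (down k m c)) (mlpoly n (down k m c)) = N a a + N h h"
    using Nha by simp
  have "cross n k k (mlpoly n c) (mlpoly n c) = cross n k k (mlpoly n a) (mlpoly n a) + cross n k k (mlpoly n a) (mlpoly n h)
     + cross n k k (mlpoly n h) (mlpoly n a) + cross n k k (mlpoly n h) (mlpoly n h)"
    unfolding c_eq by (simp only: cross_add_left cross_add_right)
  also have "cross n k k (mlpoly n a) (mlpoly n h) = cross n k k (mlpoly n h) (mlpoly n a)"
    by (rule cross_commute)
  finally have 2: "cross n k k (mlpoly n c) (mlpoly n c) = cross n k k (mlpoly n a) (mlpoly n a) + cross n k k (mlpoly n h) (mlpoly n h)"
    using orth[OF polysI[OF a(1)]] by simp
  have "eigenvalue n k m (Suc j) * cross n k k (mlpoly n a) (mlpoly n a) \<le> eigenvalue n k m j * cross n k k (mlpoly n a) (mlpoly n a)"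
    using eigenvalue_antimono[OF assms(2,3) Suc.prems(2,3)] cross_nonneg by (intro mult_right_mono)
  also have "\<dots> \<le> N a a"
    unfolding N_def using Suc.prems by (intro Suc.IH a(1)) auto
  finally show ?case unfolding 1 2 Nhh by (simp add: algebra_simps)
qed

text \<open>
Pythagoras: conditioning is an orthogonal projection in the probability space of the coupling.
\<close>

lemma down_distance:
  assumes "deg_less j c" "k \<le> m" "m \<le> n"
  shows "perm_avg n (\<lambda>\<pi>. (mlpoly n c (slice_point \<pi> k) - mlpoly n (down k m c) (slice_point \<pi> m))\<^sup>2)
    = cross n k k (mlpoly n c) (mlpoly n c) - cross n m m (mlpoly n (down k m c)) (mlpoly n (down k m c))"
proof -
  have "perm_avg n (\<lambda>\<pi>. (mlpoly n c (slice_point \<pi> k) - mlpoly n (down k m c) (slice_point \<pi> m))\<^sup>2)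
    = cross n k k (mlpoly n c) (mlpoly n c) - 2 * cross n k m (mlpoly n c) (mlpoly n (down k m c))
      + cross n m m (mlpoly n (down k m c)) (mlpoly n (down k m c))"
    unfolding cross_def
    by (simp add: power2_eq_square algebra_simps flip: perm_avg_add perm_avg_diff perm_avg_cmult)
  thus ?thesis
    using cross_down[OF polysI[OF deg_less_down[OF assms(1)]] assms(2,3)] by simp
qed

lemma down_contraction:
  assumes "deg_less j c" "k \<le> m" "m \<le> n"
  shows "cross n m m (mlpoly n (down k m c)) (mlpoly n (down k m c)) \<le> cross n k k (mlpoly n c) (mlpoly n c)"
  using down_distance[OF assms] perm_avg_nonneg[of n "\<lambda>\<pi>. (mlpoly n c (slice_point \<pi> k) - mlpoly n (down k m c) (slice_point \<pi> m))\<^sup>2"]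
  by simp

lemma down_distance_le:
  assumes "deg_less (Suc d) c" "k \<le> m" "m \<le> n" "d \<le> k" "d \<le> n - m"
  shows "perm_avg n (\<lambda>\<pi>. (mlpoly n c (slice_point \<pi> k) - mlpoly n (down k m c) (slice_point \<pi> m))\<^sup>2)
    \<le> (1 - eigenvalue n k m d) * cross n k k (mlpoly n c) (mlpoly n c)"
  unfolding down_distance[OF assms(1-3)] using down_norm_lower[OF assms] by (simp add: algebra_simps)

section \<open>Lagrange interpolation in the index of the slice\<close>

definition lagrange_coeff :: "'i set \<Rightarrow> ('i \<Rightarrow> real) \<Rightarrow> 'i \<Rightarrow> real \<Rightarrow> real" where
  "lagrange_coeff I x i z = (\<Prod>j\<in>I - {i}. (z - x j) / (x i - x j))"

lemma lagrange_coeff_node: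
  assumes "finite I" "inj_on x I" "i \<in> I" "l \<in> I"
  shows "lagrange_coeff I x i (x l) = (if i = l then 1 else 0)"
proof (cases "i = l")
  case True
  have "lagrange_coeff I x i (x i) = (\<Prod>j\<in>I - {i}. 1)"
    unfolding lagrange_coeff_def using assms by (intro prod.cong) (auto simp: inj_on_def)
  thus ?thesis using True by simp
next
  case False
  hence "l \<in> I - {i}" using assms by auto
  moreover have "(x l - x l) / (x i - x l) = 0" by simp
  ultimately have "\<exists>j\<in>I - {i}. (x l - x j) / (x i - x j) = 0" by (rule bexI[rotated])
  hence "lagrange_coeff I x i (x l) = 0"
    unfolding lagrange_coeff_def using assms(1) by (intro prod_zero) simp_all
  thus ?thesis using False by simp
qed

lemma lagrange_interpolation:
  fixes P :: "real poly"
  assumes "finite I" "inj_on x I" "degree P < card I"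
  shows "poly P z = (\<Sum>i\<in>I. lagrange_coeff I x i z * poly P (x i))"
proof -
  define L where "L = (\<lambda>i. \<Prod>j\<in>I - {i}. smult (1 / (x i - x j)) [:- x j, 1:])"
  have L: "poly (L i) z = lagrange_coeff I x i z" for i z
    unfolding L_def lagrange_coeff_def poly_prod
  proof (intro prod.cong refl)
    fix j
    show "poly (smult (1 / (x i - x j)) [:- x j, 1:]) z = (z - x j) / (x i - x j)"
      by (simp flip: diff_divide_distrib)
  qed
  have degL: "degree (L i) \<le> card I - 1" if "i \<in> I" for i
  proof -
    have "degree (L i) \<le> sum (degree \<circ> (\<lambda>j. smult (1 / (x i - x j)) [:- x j, 1:])) (I - {i})"
      unfolding L_def using assms(1) by (intro degree_prod_sum_le) simp
    also have "\<dots> \<le> (\<Sum>j\<in>I - {i}. 1)"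
      by (intro sum_mono) simp
    also have "\<dots> = card I - 1" using that assms(1) by simp
    finally show ?thesis .
  qed
  define R where "R = (\<Sum>i\<in>I. smult (poly P (x i)) (L i))"
  have "degree R \<le> card I - 1" unfolding R_def
  proof (intro degree_sum_le assms(1))
    fix i assume "i \<in> I"
    thus "degree (smult (poly P (x i)) (L i)) \<le> card I - 1"
      using degL[of i] degree_smult_le[of "poly P (x i)" "L i"] by linarith
  qed
  have R: "poly R z = (\<Sum>i\<in>I. lagrange_coeff I x i z * poly P (x i))" for z
    by (simp add: R_def poly_sum L mult.commute)
  have "P = R"
  proof (rule poly_eqI_degree[where A = "x ` I"])
    fix z assume "z \<in> x ` I"
    then obtain l where l: "l \<in> I" "z = x l" by auto
    have "poly R z = (\<Sum>i\<in>I. if i = l then poly P (x i) else 0)"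
      unfolding R l(2)
      by (intro sum.cong refl) (simp add: lagrange_coeff_node[OF assms(1,2) _ l(1)])
    thus "poly P z = poly R z" using l assms(1) by simp
  next
    show "degree P < card (x ` I)" "degree R < card (x ` I)"
      using assms \<open>degree R \<le> _\<close> by (auto simp: card_image)
  qed
  thus ?thesis using R[of z] by metis
qed

lemma ffact_interpolation:
  assumes "finite I" "inj_on x I" "j < card I"
  shows "ffact z j = (\<Sum>i\<in>I. lagrange_coeff I x i z * ffact (x i) j)"
proof -
  define P where "P = (\<Prod>i<j. [:- real i, 1:])"
  have P: "poly P z = ffact z j" for z
    by (simp add: P_def ffact_def poly_prod)
  have "degree P \<le> (\<Sum>i<j. 1)"
    unfolding P_def by (intro order.trans[OF degree_prod_sum_le] sum_mono) auto
  hence "degree P < card I" using assms(3) by simp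
  from lagrange_interpolation[OF assms(1,2) this, of z] show ?thesis by (simp add: P)
qed

text \<open>
For fixed \<open>m\<close> each coefficient of \<open>down l m c\<close> is a multiple of a falling factorial in \<open>l\<close>.
\<close>

lemma down_interpolation:
  assumes "finite I" "inj_on k I" "deg_less (card I) c"
  shows "mlpoly n (down l m c) y = (\<Sum>i\<in>I. lagrange_coeff I (\<lambda>i. real (k i)) i (real l) * mlpoly n (down (k i) m c) y)"
proof -
  have inj: "inj_on (\<lambda>i. real (k i)) I" using assms(2) by (auto simp: inj_on_def)
  have "mlpoly n (down l m c) y = (\<Sum>T\<in>Pow {1..n}. \<Sum>i\<in>I. lagrange_coeff I (\<lambda>i. real (k i)) i (real l) * (down (k i) m c T * mon T y))"
    unfolding mlpoly_def
  proof (intro sum.cong refl)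
    fix T
    show "down l m c T * mon T y = (\<Sum>i\<in>I. lagrange_coeff I (\<lambda>i. real (k i)) i (real l) * (down (k i) m c T * mon T y))"
    proof (cases "c T = 0")
      case False
      hence "card T < card I" using assms(3) by (auto simp: deg_less_def)
      thus ?thesis
        unfolding down_def ffact_interpolation[OF assms(1) inj \<open>card T < card I\<close>, of "real l"]
        by (simp add: sum_distrib_left sum_distrib_right sum_divide_distrib mult_ac)
    qed (simp add: down_def)
  qed
  also have "\<dots> = (\<Sum>i\<in>I. lagrange_coeff I (\<lambda>i. real (k i)) i (real l) * mlpoly n (down (k i) m c) y)"
    unfolding mlpoly_def sum_distrib_left by (rule sum.swap)
  finally show ?thesis .
qed

text \<open>
On 0/1 points the product of two monomials is the monomial of the union.
\<close>

lemma cross_mon_same: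
  assumes "T \<subseteq> {1..n}" "U \<subseteq> {1..n}" "l \<le> n"
  shows "cross n l l (mon T) (mon U) = ffact l (card (T \<union> U)) / ffact n (card (T \<union> U))"
proof -
  have fin: "finite T" "finite U" using finite_subset[OF assms(1)] finite_subset[OF assms(2)] by auto
  have "mon T (slice_point \<pi> l) * mon U (slice_point \<pi> l) = mon (T \<union> U) (slice_point \<pi> l)" for \<pi>
  proof -
    have sq: "mon A (slice_point \<pi> l) * mon A (slice_point \<pi> l) = mon A (slice_point \<pi> l)" for A
    proof -
      have "mon A (slice_point \<pi> l) * mon A (slice_point \<pi> l) = (\<Prod>i\<in>A. slice_point \<pi> l i * slice_point \<pi> l i)"
        unfolding mon_def by (rule prod.distrib[symmetric])
      also have "\<dots> = mon A (slice_point \<pi> l)"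
        unfolding mon_def by (intro prod.cong refl) (simp add: slice_point_def)
      finally show ?thesis .
    qed
    have "mon T (slice_point \<pi> l) * mon U (slice_point \<pi> l)
        = mon (T \<union> U) (slice_point \<pi> l) * mon (T \<inter> U) (slice_point \<pi> l)"
      unfolding mon_def using fin by (simp add: prod.union_inter)
    moreover have "mon (T \<union> U) (slice_point \<pi> l) = mon (T \<union> U - T \<inter> U) (slice_point \<pi> l) * mon (T \<inter> U) (slice_point \<pi> l)"
      unfolding mon_def using fin by (intro prod.subset_diff) auto
    ultimately show ?thesis using sq[of "T \<inter> U"] by (metis mult.assoc)
  qed
  hence "cross n l l (mon T) (mon U) = joint_moment n l l (T \<union> U) {}"
    by (simp add: cross_def joint_moment_def comon_def)
  thus ?thesis using assms by (simp add: joint_moment_formula)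
qed

text \<open>
The squared norm on slice \<open>l\<close> is a polynomial of degree at most \<open>2 d\<close> in \<open>l\<close>.
\<close>

lemma cross_interpolation:
  assumes "finite I" "inj_on k I" "2 * d < card I" "deg_less (Suc d) c" "l \<le> n" "\<And>i. i \<in> I \<Longrightarrow> k i \<le> n"
  shows "cross n l l (mlpoly n c) (mlpoly n c)
    = (\<Sum>i\<in>I. lagrange_coeff I (\<lambda>i. real (k i)) i (real l) * cross n (k i) (k i) (mlpoly n c) (mlpoly n c))"
proof -
  have inj: "inj_on (\<lambda>i. real (k i)) I" using assms(2) by (auto simp: inj_on_def)
  have Q: "cross n l l (mlpoly n c) (mlpoly n c) = (\<Sum>T\<in>Pow {1..n}. \<Sum>U\<in>Pow {1..n}.
       c T * c U / ffact n (card (T \<union> U)) * ffact l (card (T \<union> U)))" if "l \<le> n" for l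
    unfolding cross_mlpoly_left unfolding cross_mlpoly_right sum_distrib_left
  proof (intro sum.cong refl)
    fix T U assume "T \<in> Pow {1..n}" "U \<in> Pow {1..n}"
    hence "cross n l l (mon T) (mon U) = ffact l (card (T \<union> U)) / ffact n (card (T \<union> U))"
      using that by (intro cross_mon_same) auto
    thus "c T * (c U * cross n l l (mon T) (mon U)) = c T * c U / ffact n (card (T \<union> U)) * ffact l (card (T \<union> U))"
      by simp
  qed
  have "cross n l l (mlpoly n c) (mlpoly n c) = (\<Sum>T\<in>Pow {1..n}. \<Sum>U\<in>Pow {1..n}. \<Sum>i\<in>I.
       lagrange_coeff I (\<lambda>i. real (k i)) i (real l) * (c T * c U / ffact n (card (T \<union> U)) * ffact (k i) (card (T \<union> U))))"
    unfolding Q[OF assms(5)]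
  proof (intro sum.cong refl)
    fix T U
    show "c T * c U / ffact n (card (T \<union> U)) * ffact l (card (T \<union> U)) = (\<Sum>i\<in>I.
       lagrange_coeff I (\<lambda>i. real (k i)) i (real l) * (c T * c U / ffact n (card (T \<union> U)) * ffact (k i) (card (T \<union> U))))"
    proof (cases "c T = 0 \<or> c U = 0")
      case False
      hence "card T \<le> d" "card U \<le> d" using assms(4) by (auto simp: deg_less_def)
      hence "card (T \<union> U) < card I" using card_Un_le[of T U] assms(3) by linarith
      thus ?thesis
        unfolding ffact_interpolation[OF assms(1) inj \<open>card (T \<union> U) < card I\<close>, of "real l"]
        by (simp add: sum_distrib_left sum_distrib_right sum_divide_distrib mult_ac)
    qed auto
  qed
  also have "\<dots> = (\<Sum>T\<in>Pow {1..n}. \<Sum>i\<in>I. \<Sum>U\<in>Pow {1..n}.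
       lagrange_coeff I (\<lambda>i. real (k i)) i (real l) * (c T * c U / ffact n (card (T \<union> U)) * ffact (k i) (card (T \<union> U))))"
    by (intro sum.cong refl sum.swap)
  also have "\<dots> = (\<Sum>i\<in>I. \<Sum>T\<in>Pow {1..n}. \<Sum>U\<in>Pow {1..n}.
       lagrange_coeff I (\<lambda>i. real (k i)) i (real l) * (c T * c U / ffact n (card (T \<union> U)) * ffact (k i) (card (T \<union> U))))"
    by (rule sum.swap)
  also have "\<dots> = (\<Sum>i\<in>I. lagrange_coeff I (\<lambda>i. real (k i)) i (real l) * cross n (k i) (k i) (mlpoly n c) (mlpoly n c))"
    by (intro sum.cong refl) (simp add: Q[OF assms(6)] sum_distrib_left)
  finally show ?thesis .
qed

lemma lagrange_coeff_bound:
  assumes "finite I" "i \<in> I" "0 < e" "0 \<le> b" "\<And>j. j \<in> I \<Longrightarrow> j \<noteq> i \<Longrightarrow> \<bar>z - x j\<bar> \<le> b"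
    "\<And>j. j \<in> I \<Longrightarrow> j \<noteq> i \<Longrightarrow> e \<le> \<bar>x i - x j\<bar>"
  shows "\<bar>lagrange_coeff I x i z\<bar> \<le> (b / e) ^ (card I - 1)"
proof -
  have "\<bar>lagrange_coeff I x i z\<bar> = (\<Prod>j\<in>I - {i}. \<bar>z - x j\<bar> / \<bar>x i - x j\<bar>)"
    by (simp add: lagrange_coeff_def abs_prod)
  also have "\<dots> \<le> (\<Prod>j\<in>I - {i}. b / e)"
    using assms by (intro prod_mono conjI frac_le) auto
  also have "\<dots> = (b / e) ^ (card I - 1)" using assms by simp
  finally show ?thesis .
qed

section \<open>Exponential moments of the binomial distribution\<close>

text \<open>
For negative \<open>x\<close> this is the lower bound \<open>1 + y + y^2 / 2\<close> for \<open>exp y\<close> at \<open>y = - x\<close>, inverted.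
\<close>

lemma exp_le_quadratic:
  fixes x :: real
  assumes "\<bar>x\<bar> \<le> 1"
  shows "exp x \<le> 1 + x + x\<^sup>2"
proof (cases "0 \<le> x")
  case True
  thus ?thesis using exp_bound[of x] assms by simp
next
  case False
  define y where "y = - x"
  have y: "0 \<le> y" using False by (simp add: y_def)
  have "1 \<le> (1 - y + y\<^sup>2) * (1 + y + y\<^sup>2 / 2)"
  proof -
    have "(1 - y + y\<^sup>2) * (1 + y + y\<^sup>2 / 2) = 1 + (y\<^sup>2 + y ^ 3 + y ^ 4) / 2"
      by (simp add: algebra_simps add_divide_distrib diff_divide_distrib power2_eq_square power3_eq_cube power4_eq_xxxx)
    thus ?thesis using y by simp
  qed
  also have "\<dots> \<le> (1 - y + y\<^sup>2) * exp y"
  proof (rule mult_left_mono)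
    show "1 + y + y\<^sup>2 / 2 \<le> exp y" using exp_lower_Taylor_quadratic[OF y] by simp
    have "0 \<le> (y - 1 / 2)\<^sup>2 + 3 / 4" by simp
    thus "0 \<le> 1 - y + y\<^sup>2" by (simp add: power2_eq_square algebra_simps)
  qed
  finally show ?thesis by (simp add: y_def exp_minus field_simps)
qed

lemma power_le_fact_exp:
  fixes x :: real
  assumes "0 \<le> x"
  shows "x ^ j \<le> fact j * exp x"
proof -
  have s: "(\<lambda>i. x ^ i / fact i) sums exp x"
    using exp_converges[of x] by (simp add: field_simps)
  have "(\<Sum>i\<in>{j}. x ^ i / fact i) \<le> suminf (\<lambda>i. x ^ i / fact i)"
    using assms by (intro sum_le_suminf sums_summable[OF s]) auto
  hence "x ^ j / fact j \<le> exp x" using sums_unique[OF s] by simp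
  thus ?thesis by (simp add: field_simps)
qed

definition bin_weight :: "nat \<Rightarrow> real \<Rightarrow> nat \<Rightarrow> real" where
  "bin_weight n p l = real (n choose l) * p ^ l * (1 - p) ^ (n - l)"

lemma bin_weight_nonneg: "0 \<le> p \<Longrightarrow> p \<le> 1 \<Longrightarrow> 0 \<le> bin_weight n p l"
  by (simp add: bin_weight_def)

lemma sum_bin_weight: "(\<Sum>l\<le>n. bin_weight n p l) = 1"
  using binomial_ring[of p "1 - p" n] by (simp add: bin_weight_def)

text \<open>
The binomial theorem turns the sum into the \<open>n\<close>-th power of the one-variable moment generating function;
for that one, the linear terms of the quadratic bound cancel because the variable is centred.
\<close>

lemma binomial_mgf:
  assumes "0 \<le> p" "p \<le> 1" "\<bar>\<theta>\<bar> \<le> 1"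
  shows "(\<Sum>l\<le>n. bin_weight n p l * exp (\<theta> * (real l - real n * p))) \<le> exp (\<theta>\<^sup>2 * (real n * p * (1 - p)))"
proof -
  let ?g = "p * exp (\<theta> * (1 - p)) + (1 - p) * exp (- \<theta> * p)"
  have "?g ^ n = (\<Sum>l\<le>n. real (n choose l) * (p * exp (\<theta> * (1 - p))) ^ l * ((1 - p) * exp (- \<theta> * p)) ^ (n - l))"
    by (rule binomial_ring)
  also have "\<dots> = (\<Sum>l\<le>n. bin_weight n p l * exp (\<theta> * (real l - real n * p)))"
  proof (intro sum.cong refl)
    fix l assume "l \<in> {..n}"
    hence l: "l \<le> n" by simp
    have "exp (\<theta> * (1 - p)) ^ l * exp (- \<theta> * p) ^ (n - l) = exp (real l * (\<theta> * (1 - p)) + real (n - l) * (- \<theta> * p))"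
      by (simp only: exp_of_nat_mult exp_add)
    also have "real l * (\<theta> * (1 - p)) + real (n - l) * (- \<theta> * p) = \<theta> * (real l - real n * p)"
      using l by (simp add: of_nat_diff algebra_simps)
    finally have "exp (\<theta> * (real l - real n * p)) = exp (\<theta> * (1 - p)) ^ l * exp (- \<theta> * p) ^ (n - l)" ..
    thus "real (n choose l) * (p * exp (\<theta> * (1 - p))) ^ l * ((1 - p) * exp (- \<theta> * p)) ^ (n - l)
        = bin_weight n p l * exp (\<theta> * (real l - real n * p))"
      by (simp only: bin_weight_def power_mult_distrib mult_ac)
  qed
  finally have eq: "(\<Sum>l\<le>n. bin_weight n p l * exp (\<theta> * (real l - real n * p))) = ?g ^ n" ..
  have "\<bar>\<theta> * (1 - p)\<bar> \<le> 1 * 1" "\<bar>- \<theta> * p\<bar> \<le> 1 * 1"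
    unfolding abs_mult using assms by (intro mult_mono; simp)+
  hence "?g \<le> p * (1 + \<theta> * (1 - p) + (\<theta> * (1 - p))\<^sup>2) + (1 - p) * (1 + (- \<theta> * p) + (- \<theta> * p)\<^sup>2)"
    using assms by (intro add_mono mult_left_mono exp_le_quadratic) auto
  also have "\<dots> = 1 + \<theta>\<^sup>2 * (p * (1 - p))" by (simp add: power2_eq_square algebra_simps)
  also have "\<dots> \<le> exp (\<theta>\<^sup>2 * (p * (1 - p)))" by (rule exp_ge_add_one_self)
  finally have "?g ^ n \<le> exp (\<theta>\<^sup>2 * (p * (1 - p))) ^ n"
    using assms by (intro power_mono add_nonneg_nonneg) auto
  also have "\<dots> = exp (real n * (\<theta>\<^sup>2 * (p * (1 - p))))"
    by (simp only: exp_of_nat_mult)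
  also have "real n * (\<theta>\<^sup>2 * (p * (1 - p))) = \<theta>\<^sup>2 * (real n * p * (1 - p))" by simp
  finally show ?thesis unfolding eq .
qed

section \<open>Laws of the slices, of the cube and of the mixture\<close>

lemma finite_cube: "finite (cube n)"
  unfolding cube_def by (intro finite_PiE_dflt) auto

lemma cube_01: "x \<in> cube n \<Longrightarrow> x i = 0 \<or> x i = 1"
  by (cases "i \<in> {1..n}") (auto simp: cube_def PiE_dflt_def)

lemma slice_subset_cube: "slice n l \<subseteq> cube n"
  by (auto simp: slice_def)

lemma finite_slice: "finite (slice n l)"
  using finite_subset[OF slice_subset_cube finite_cube] .

lemma cube_sum_eq_card: "x \<in> cube n \<Longrightarrow> (\<Sum>i\<in>{1..n}. x i) = real (card {i\<in>{1..n}. x i = 1})"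
proof -
  assume x: "x \<in> cube n"
  have "(\<Sum>i\<in>{1..n}. x i) = (\<Sum>i\<in>{1..n}. if x i = 1 then 1 else 0)"
    using cube_01[OF x] by (intro sum.cong) auto
  also have "\<dots> = real (card {i\<in>{1..n}. x i = 1})" by (simp flip: sum.inter_filter)
  finally show ?thesis .
qed

lemma slice_point_in_slice:
  assumes "\<pi> permutes {1..n}" "l \<le> n"
  shows "slice_point \<pi> l \<in> slice n l"
proof -
  have "\<pi> ` {1..l} \<subseteq> {1..n}"
    using permutes_image[OF assms(1)] assms(2) by (metis image_mono atLeastatMost_subset_iff order_refl)
  hence "slice_point \<pi> l \<in> cube n"
    by (auto simp: cube_def PiE_dflt_def slice_point_def)
  thus ?thesis using slice_point_sum[OF assms] by (simp add: slice_def)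
qed

text \<open>
A point \<open>X(l)\<close> with \<open>l\<close> ones equals \<open>x\<close> as soon as it contains the support of \<open>x\<close>, so the probability is
a joint moment; that it does not depend on \<open>x\<close> makes \<open>X(l)\<close> uniform.
\<close>

lemma slice_point_probability:
  assumes "l \<le> n" "x \<in> slice n l"
  shows "pmf (map_pmf (\<lambda>\<pi>. slice_point \<pi> l) (pmf_of_set {\<pi>. \<pi> permutes {1..n}})) x
    = ffact l l / ffact n l"
proof -
  define T where "T = {i\<in>{1..n}. x i = 1}"
  have x: "x \<in> cube n" using assms(2) slice_subset_cube by auto
  have cT: "card T = l" using assms(2) cube_sum_eq_card[OF x] by (simp add: slice_def T_def)
  have x_eq: "x = (\<lambda>i. if i \<in> T then 1 else 0)"
  proof
    fix i show "x i = (if i \<in> T then 1 else 0)"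
      using x cube_01[OF x, of i] unfolding T_def
      by (cases "i \<in> {1..n}") (auto simp: cube_def PiE_dflt_def)
  qed
  have ind: "mon T (slice_point \<pi> l) = indicator {\<pi>. slice_point \<pi> l = x} \<pi>" if \<pi>: "\<pi> permutes {1..n}" for \<pi>
  proof (cases "T \<subseteq> \<pi> ` {1..l}")
    case True
    have "card (\<pi> ` {1..l}) = l" using permutes_inj_on[OF \<pi>] by (simp add: card_image)
    hence "T = \<pi> ` {1..l}" using True cT by (intro card_subset_eq) auto
    hence "slice_point \<pi> l = x" unfolding x_eq by (simp add: slice_point_def)
    moreover have "mon T (slice_point \<pi> l) = 1"
      using True unfolding mon_def slice_point_def by (intro prod.neutral) auto
    ultimately show ?thesis by simp
  next
    case False
    then obtain i where i: "i \<in> T" "i \<notin> \<pi> ` {1..l}" by auto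
    have z: "slice_point \<pi> l i = 0" using i by (simp add: slice_point_def)
    hence "mon T (slice_point \<pi> l) = 0"
      unfolding mon_def using i by (intro prod_zero bexI[of _ i]) (auto simp: T_def)
    moreover have "slice_point \<pi> l \<noteq> x"
    proof
      assume "slice_point \<pi> l = x"
      hence "slice_point \<pi> l i = 1" using i(1) by (simp add: T_def)
      thus False using z by simp
    qed
    ultimately show ?thesis by simp
  qed
  have "pmf (map_pmf (\<lambda>\<pi>. slice_point \<pi> l) (pmf_of_set {\<pi>. \<pi> permutes {1..n}})) x
     = measure_pmf.expectation (pmf_of_set {\<pi>. \<pi> permutes {1..n}}) (indicator {\<pi>. slice_point \<pi> l = x})"
    by (simp add: pmf_map vimage_def)
  also have "\<dots> = perm_avg n (indicator {\<pi>. slice_point \<pi> l = x})"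
    by (rule perm_avg_expectation)
  also have "\<dots> = perm_avg n (\<lambda>\<pi>. mon T (slice_point \<pi> l))"
    by (intro perm_avg_cong) (simp add: ind)
  also have "\<dots> = joint_moment n l l T {}" by (simp add: joint_moment_def comon_def)
  also have "\<dots> = ffact l l / ffact n l"
    using assms(1) cT by (subst joint_moment_formula) (auto simp: T_def)
  finally show ?thesis .
qed

lemma slice_point_distribution:
  assumes "l \<le> n"
  shows "map_pmf (\<lambda>\<pi>. slice_point \<pi> l) (pmf_of_set {\<pi>. \<pi> permutes {1..n}}) = slice_pmf n l"
    and "real (card (slice n l)) * (ffact l l / ffact n l) = 1"
proof -
  let ?P = "map_pmf (\<lambda>\<pi>. slice_point \<pi> l) (pmf_of_set {\<pi>. \<pi> permutes {1..n}})"
  have supp: "set_pmf ?P \<subseteq> slice n l"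
    unfolding set_map_pmf set_pmf_of_set[OF perms_nonempty finite_perms]
    using slice_point_in_slice[OF _ assms] by blast
  have ne: "slice n l \<noteq> {}" using supp set_pmf_not_empty[of ?P] by auto
  have "1 = (\<Sum>x\<in>slice n l. pmf ?P x)"
    using sum_pmf_eq_1[OF finite_slice supp] by simp
  also have "\<dots> = (\<Sum>x\<in>slice n l. ffact l l / ffact n l)"
    by (intro sum.cong refl slice_point_probability assms)
  also have "\<dots> = real (card (slice n l)) * (ffact l l / ffact n l)"
    by (simp only: sum_constant)
  finally show *: "real (card (slice n l)) * (ffact l l / ffact n l) = 1" ..
  show "?P = slice_pmf n l"
  proof (rule pmf_eqI)
    fix x
    show "pmf ?P x = pmf (slice_pmf n l) x"
    proof (cases "x \<in> slice n l")
      case True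
      have "card (slice n l) \<noteq> 0" using ne finite_slice by (simp add: card_eq_0_iff)
      hence "ffact l l / ffact n l = 1 / real (card (slice n l))"
        using * by (metis of_nat_eq_0_iff nonzero_eq_divide_eq mult.commute)
      thus ?thesis unfolding slice_point_probability[OF assms True] slice_pmf_def
        using True ne finite_slice by simp
    next
      case False
      hence "x \<notin> set_pmf ?P" using supp by auto
      hence "pmf ?P x = 0" unfolding pmf_eq_0_set_pmf .
      thus ?thesis using False ne finite_slice by (simp add: slice_pmf_def)
    qed
  qed
qed

lemma slice_expectation:
  assumes "l \<le> n"
  shows "measure_pmf.expectation (slice_pmf n l) h = perm_avg n (\<lambda>\<pi>. h (slice_point \<pi> l))"
  unfolding slice_point_distribution(1)[OF assms, symmetric] integral_map_pmf perm_avg_expectation ..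

lemma card_slice:
  assumes "l \<le> n"
  shows "real (card (slice n l)) = real (n choose l)"
proof -
  have f: "ffact a l = fact l * (a gchoose l)" for a
    by (simp add: ffact_def gbinomial_prod_rev atLeast0LessThan)
  have "(real l gchoose l) = 1" by (simp flip: binomial_gbinomial)
  moreover have "(real n gchoose l) = real (n choose l)" by (simp flip: binomial_gbinomial)
  moreover have "real (n choose l) > 0" using assms by simp
  ultimately show ?thesis
    using slice_point_distribution(2)[OF assms] unfolding f by (simp add: field_simps)
qed

text \<open>
The product measure gives all points of a slice the same mass, so it is the binomial mixture of slices.
\<close>

lemma cube_expectation:
  assumes p: "0 < p" "p < 1"
  shows "measure_pmf.expectation (cube_pmf n p) h
    = (\<Sum>l\<le>n. bin_weight n p l * perm_avg n (\<lambda>\<pi>. h (slice_point \<pi> l)))"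
proof -
  let ?B = "map_pmf of_bool (bernoulli_pmf p) :: real pmf"
  have B1: "pmf ?B 1 = p" "pmf ?B 0 = 1 - p"
    using pmf_map_inj'[of "of_bool :: bool \<Rightarrow> real" "bernoulli_pmf p" True]
      pmf_map_inj'[of "of_bool :: bool \<Rightarrow> real" "bernoulli_pmf p" False] p
    by (auto simp: inj_def)
  have supp: "set_pmf (cube_pmf n p) \<subseteq> cube n"
  proof -
    have "set_pmf ?B \<subseteq> {0, 1}" by auto
    thus ?thesis unfolding cube_pmf_def cube_def set_Pi_pmf[OF finite_atLeastAtMost] PiE_dflt_def
      by (auto simp del: set_map_pmf)
  qed
  have pm: "pmf (cube_pmf n p) x = p ^ l * (1 - p) ^ (n - l)" if x: "x \<in> slice n l" for x l
  proof -
    let ?T = "{i\<in>{1..n}. x i = 1}"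
    have xc: "x \<in> cube n" using x slice_subset_cube by auto
    have c: "card ?T = l" using x cube_sum_eq_card[OF xc] by (simp add: slice_def)
    have "pmf (cube_pmf n p) x = (\<Prod>i\<in>{1..n}. pmf ?B (x i))"
      unfolding cube_pmf_def using xc by (intro pmf_Pi') (auto simp: cube_def PiE_dflt_def)
    also have "\<dots> = (\<Prod>i\<in>{1..n}. if x i = 1 then p else 1 - p)"
    proof (intro prod.cong refl)
      fix i show "pmf ?B (x i) = (if x i = 1 then p else 1 - p)"
        using cube_01[OF xc, of i] B1 by auto
    qed
    also have "\<dots> = p ^ card ?T * (1 - p) ^ card ({1..n} - ?T)"
    proof -
      have "{1..n} \<inter> {i. x i = 1} = ?T" "{1..n} \<inter> - {i. x i = 1} = {1..n} - ?T" by auto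
      thus ?thesis by (subst prod.If_cases) (simp_all only: prod_constant finite_atLeastAtMost)
    qed
    also have "card ({1..n} - ?T) = n - l" using c by (subst card_Diff_subset) auto
    finally show ?thesis by (simp only: c)
  qed
  have cube_Un: "cube n = (\<Union>l\<in>{..n}. slice n l)"
  proof
    show "cube n \<subseteq> (\<Union>l\<in>{..n}. slice n l)"
    proof
      fix x assume x: "x \<in> cube n"
      let ?l = "card {i\<in>{1..n}. x i = 1}"
      have "?l \<le> card {1..n}" by (intro card_mono) auto
      hence "?l \<le> n" by simp
      moreover have "x \<in> slice n ?l" using x cube_sum_eq_card[OF x] by (simp add: slice_def)
      ultimately show "x \<in> (\<Union>l\<in>{..n}. slice n l)" by blast
    qed
    show "(\<Union>l\<in>{..n}. slice n l) \<subseteq> cube n" by (intro UN_least slice_subset_cube)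
  qed
  have "measure_pmf.expectation (cube_pmf n p) h = (\<Sum>x\<in>cube n. pmf (cube_pmf n p) x * h x)"
    using supp by (subst integral_measure_pmf[OF finite_cube]) auto
  also have "\<dots> = (\<Sum>l\<le>n. \<Sum>x\<in>slice n l. pmf (cube_pmf n p) x * h x)"
    unfolding cube_Un
  proof (intro sum.UNION_disjoint ballI impI finite_slice)
    fix i j :: nat assume "i \<noteq> j"
    thus "slice n i \<inter> slice n j = {}" by (simp add: slice_def disjoint_iff)
  qed simp
  also have "\<dots> = (\<Sum>l\<le>n. bin_weight n p l * perm_avg n (\<lambda>\<pi>. h (slice_point \<pi> l)))"
  proof (intro sum.cong refl)
    fix l assume "l \<in> {..n}"
    hence l: "l \<le> n" by simp
    have pos: "real (card (slice n l)) > 0" using l unfolding card_slice[OF l] by simp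
    have ne: "slice n l \<noteq> {}" using pos by auto
    have "perm_avg n (\<lambda>\<pi>. h (slice_point \<pi> l)) = (\<Sum>x\<in>slice n l. h x) / real (card (slice n l))"
      unfolding slice_expectation[OF l, symmetric] slice_pmf_def
      by (rule integral_pmf_of_set[OF ne finite_slice])
    hence "(\<Sum>x\<in>slice n l. h x) = real (n choose l) * perm_avg n (\<lambda>\<pi>. h (slice_point \<pi> l))"
      using pos unfolding card_slice[OF l] by simp
    moreover have "(\<Sum>x\<in>slice n l. pmf (cube_pmf n p) x * h x) = p ^ l * (1 - p) ^ (n - l) * (\<Sum>x\<in>slice n l. h x)"
      unfolding sum_distrib_left by (intro sum.cong refl) (simp add: pm)
    ultimately show "(\<Sum>x\<in>slice n l. pmf (cube_pmf n p) x * h x) = bin_weight n p l * perm_avg n (\<lambda>\<pi>. h (slice_point \<pi> l))"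
      by (simp add: bin_weight_def)
  qed
  finally show ?thesis .
qed

text \<open>
The exponents of a squarefree monomial carry no information beyond its set of variables, so coefficients
can be collected by that set.
\<close>

lemma poly_eval_eq_mlpoly:
  assumes "multilinear_poly f" "in_variables {1..n} f" "total_degree f = d"
  obtains c where "deg_less (Suc d) c" "poly_eval f = mlpoly n c"
proof -
  define c where "c T = (\<Sum>m | m \<in> Poly_Mapping.keys f \<and> Poly_Mapping.keys m = T. Poly_Mapping.lookup f m)" for T
  have one: "Poly_Mapping.lookup m i = 1" if "m \<in> Poly_Mapping.keys f" "i \<in> Poly_Mapping.keys m" for m i
  proof -
    have "Poly_Mapping.lookup m i \<le> 1" using assms(1) that(1) by (auto simp: multilinear_poly_def squarefree_monom_def)
    moreover have "Poly_Mapping.lookup m i \<noteq> 0" using that(2) by (simp add: in_keys_iff)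
    ultimately show ?thesis by simp
  qed
  have "deg_less (Suc d) c"
    unfolding deg_less_def
  proof (intro allI impI)
    fix T assume "c T \<noteq> 0"
    hence "{m. m \<in> Poly_Mapping.keys f \<and> Poly_Mapping.keys m = T} \<noteq> {}"
      unfolding c_def by (metis sum.empty)
    then obtain m where m: "m \<in> Poly_Mapping.keys f" "Poly_Mapping.keys m = T" by blast
    have "card T = monom_degree m" using one[OF m(1)] m(2) by (simp add: monom_degree_def)
    also have "\<dots> \<le> total_degree f" unfolding total_degree_def using m(1) by (intro Max_ge) auto
    finally show "card T < Suc d" using assms(3) by simp
  qed
  moreover have "poly_eval f = mlpoly n c"
  proof
    fix x
    have "poly_eval f x = (\<Sum>m\<in>Poly_Mapping.keys f. Poly_Mapping.lookup f m * mon (Poly_Mapping.keys m) x)"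
      unfolding poly_eval_def
    proof (intro sum.cong refl)
      fix m assume m: "m \<in> Poly_Mapping.keys f"
      have "monom_eval m x = mon (Poly_Mapping.keys m) x"
        unfolding monom_eval_def mon_def by (intro prod.cong refl) (simp add: one[OF m])
      thus "Poly_Mapping.lookup f m * monom_eval m x = Poly_Mapping.lookup f m * mon (Poly_Mapping.keys m) x"
        by simp
    qed
    also have "\<dots> = (\<Sum>T\<in>Pow {1..n}. \<Sum>m | m \<in> Poly_Mapping.keys f \<and> Poly_Mapping.keys m = T.
        Poly_Mapping.lookup f m * mon (Poly_Mapping.keys m) x)"
      using assms(2) by (intro sum.group[symmetric]) (auto simp: in_variables_def)
    also have "\<dots> = mlpoly n c x"
      unfolding mlpoly_def c_def sum_distrib_right by (intro sum.cong refl) auto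
    finally show "poly_eval f x = mlpoly n c x" .
  qed
  ultimately show ?thesis by (rule that)
qed

lemma mixture_expectation:
  assumes "finite A" "set_pmf N \<subseteq> A"
  shows "measure_pmf.expectation (mixture_pmf r \<gamma> N (profile_pmf n r k f)) \<phi>
    = (\<Sum>l\<in>A. pmf N l * perm_avg n (\<lambda>\<pi>. \<phi> (\<Sum>i\<in>{1..r}. \<gamma> l i * f (slice_point \<pi> (k i)))))"
proof -
  let ?P = "profile_pmf n r k f"
  have fin: "finite (set_pmf ?P)"
    unfolding profile_pmf_def set_map_pmf set_pmf_of_set[OF perms_nonempty finite_perms]
    by (intro finite_imageI finite_perms)
  have "mixture_pmf r \<gamma> N ?P = bind_pmf N (\<lambda>l. map_pmf (\<lambda>y. \<Sum>i\<in>{1..r}. \<gamma> l i * y i) ?P)"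
    by (simp add: mixture_pmf_def pair_pmf_def map_bind_pmf map_pmf_def bind_assoc_pmf bind_return_pmf)
  hence "measure_pmf.expectation (mixture_pmf r \<gamma> N ?P) \<phi>
      = (\<Sum>l\<in>A. pmf N l *\<^sub>R measure_pmf.expectation (map_pmf (\<lambda>y. \<Sum>i\<in>{1..r}. \<gamma> l i * y i) ?P) \<phi>)"
    using assms fin by (simp only:) (intro pmf_expectation_bind, auto)
  also have "\<dots> = (\<Sum>l\<in>A. pmf N l * perm_avg n (\<lambda>\<pi>. \<phi> (\<Sum>i\<in>{1..r}. \<gamma> l i * f (slice_point \<pi> (k i)))))"
  proof (intro sum.cong refl)
    fix l
    have "measure_pmf.expectation (map_pmf (\<lambda>y. \<Sum>i\<in>{1..r}. \<gamma> l i * y i) ?P) \<phi>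
        = perm_avg n (\<lambda>\<pi>. \<phi> (\<Sum>i\<in>{1..r}. \<gamma> l i * f (slice_point \<pi> (k i))))"
      unfolding profile_pmf_def integral_map_pmf perm_avg_expectation
      by (intro perm_avg_cong arg_cong[where f = \<phi>] sum.cong refl) simp
    thus "pmf N l *\<^sub>R measure_pmf.expectation (map_pmf (\<lambda>y. \<Sum>i\<in>{1..r}. \<gamma> l i * y i) ?P) \<phi>
        = pmf N l * perm_avg n (\<lambda>\<pi>. \<phi> (\<Sum>i\<in>{1..r}. \<gamma> l i * f (slice_point \<pi> (k i))))"
      by simp
  qed
  finally show ?thesis .
qed

lemma trunc_binomial:
  fixes n :: nat and p s :: real
  assumes p: "0 < p" "p < 1"
  defines "I \<equiv> {l\<in>{..n}. \<bar>sigma_dev p n l\<bar> \<le> s}"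
  assumes pos: "0 < (\<Sum>l\<in>I. bin_weight n p l)"
  shows "set_pmf (trunc_binomial_pmf n p s) \<subseteq> I"
    and "l \<in> I \<Longrightarrow> pmf (trunc_binomial_pmf n p s) l = bin_weight n p l / (\<Sum>l\<in>I. bin_weight n p l)"
proof -
  let ?S = "{k. \<bar>sigma_dev p n k\<bar> \<le> s}"
  have pm: "pmf (binomial_pmf n p) l = bin_weight n p l" for l
    using p by (simp add: bin_weight_def)
  have supp: "set_pmf (binomial_pmf n p) = {..n}" using p by (simp add: set_pmf_binomial_eq)
  have I: "I = ?S \<inter> {..n}" by (auto simp: I_def)
  have ne: "set_pmf (binomial_pmf n p) \<inter> ?S \<noteq> {}"
    using pos unfolding supp I by (intro notI) (simp add: Int_commute)
  have "measure (binomial_pmf n p) ?S = measure (binomial_pmf n p) (?S \<inter> {..n})"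
    using measure_Int_set_pmf[of "binomial_pmf n p" ?S] by (simp add: supp)
  also have "\<dots> = (\<Sum>l\<in>I. bin_weight n p l)"
    unfolding I[symmetric] by (subst measure_measure_pmf_finite) (auto simp: pm I_def)
  finally have m: "measure (binomial_pmf n p) ?S = (\<Sum>l\<in>I. bin_weight n p l)" .
  show "set_pmf (trunc_binomial_pmf n p s) \<subseteq> I"
    unfolding trunc_binomial_pmf_def set_cond_pmf[OF ne] supp I by auto
  show "pmf (trunc_binomial_pmf n p s) l = bin_weight n p l / (\<Sum>l\<in>I. bin_weight n p l)" if "l \<in> I"
    using that unfolding trunc_binomial_pmf_def pmf_cond[OF ne] m by (simp only: pm) (simp add: I_def)
qed

section \<open>Comparison of nearby slices\<close>

text \<open>
Inside this context, \<open>W\<close> is the standard deviation \<open>sqrt (n p (1 - p))\<close>.  The bound on \<open>M\<close> together with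
\<open>1 \<le> M\<close> forces \<open>W \<ge> 9 d M \<ge> 9\<close>.
\<close>

locale slice_system =
  fixes p :: real and n d :: nat and \<eta> M :: real and k :: "nat \<Rightarrow> nat"
  assumes p: "0 < p" "p < 1" and d: "1 \<le> d"
    and system: "eta_M_system p n \<eta> M (d + 1) k"
    and M_le: "M \<le> sqrt (real n * p * (1 - p)) / (9 * real d)"
begin

definition W :: real where "W = sqrt (real n * p * (1 - p))"

abbreviation \<sigma> :: "nat \<Rightarrow> real" where "\<sigma> \<equiv> sigma_dev p n"

definition \<gamma> :: "nat \<Rightarrow> nat \<Rightarrow> real" where
  "\<gamma> l i = lagrange_coeff {1..d + 1} (\<lambda>i. real (k i)) i (real l)"

text \<open>
The threshold \<open>9/20\<close> is large enough for all the slices that occur (the given ones, the central ones and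
those up to the truncation point) and small enough that such a slice is at distance at least
\<open>n p / 2 + d\<close> and \<open>n (1 - p) / 2 + d\<close> from the two ends.
\<close>

definition near :: "nat \<Rightarrow> bool" where
  "near l \<longleftrightarrow> \<bar>\<sigma> l\<bar> \<le> 9 / 20 * W"

abbreviation Q :: "(nat set \<Rightarrow> real) \<Rightarrow> nat \<Rightarrow> real" where
  "Q c l \<equiv> cross n l l (mlpoly n c) (mlpoly n c)"

lemma eta: "0 < \<eta>" "\<eta> \<le> 1" and M: "1 \<le> M"
  and k_le: "\<And>i. i \<in> {1..d + 1} \<Longrightarrow> k i \<le> n"
  and k_sep: "\<And>i j. i \<in> {1..d + 1} \<Longrightarrow> j \<in> {1..d + 1} \<Longrightarrow> i \<noteq> j \<Longrightarrow> \<eta> \<le> \<bar>\<sigma> (k i) - \<sigma> (k j)\<bar>"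
  and k_M: "\<And>i. i \<in> {1..d + 1} \<Longrightarrow> \<bar>\<sigma> (k i)\<bar> \<le> M"
  using system by (auto simp: eta_M_system_def)

lemma W_ge: "9 * real d * M \<le> W"
  using M_le d by (simp add: W_def field_simps)

lemma W_ge': "9 * real d \<le> W" "9 \<le> W" "9 * M \<le> W"
proof -
  have d1: "1 \<le> real d" using d by simp
  have "9 * real d * 1 \<le> 9 * real d * M" using M by (intro mult_left_mono) auto
  thus a: "9 * real d \<le> W" using W_ge by simp
  thus "9 \<le> W" using d1 by linarith
  have "9 * 1 * M \<le> 9 * real d * M" using M d1 by (intro mult_right_mono mult_left_mono) auto
  thus "9 * M \<le> W" using W_ge by simp
qed

lemma W_sq: "W\<^sup>2 = real n * p * (1 - p)"
  using p by (simp add: W_def)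

lemma sigma_eq: "real l = real n * p + \<sigma> l * W"
  using W_ge'(2) by (simp add: sigma_dev_def flip: W_def)

lemma W_sq_ge: "81 * real d \<le> W\<^sup>2"
proof -
  have "9 * real d * 9 \<le> W * W" using W_ge' by (intro mult_mono) auto
  thus ?thesis by (simp add: power2_eq_square)
qed

lemma near_imp:
  assumes "near l"
  shows "l \<le> n" "d \<le> l" "d \<le> n - l"
    "real n * p / 2 \<le> real l - real d" "real n * (1 - p) / 2 \<le> real (n - l) - real d"
proof -
  have "\<bar>\<sigma> l * W\<bar> \<le> 9 / 20 * W * W"
    using assms W_ge'(2) unfolding near_def abs_mult by (intro mult_mono) auto
  hence l: "\<bar>real l - real n * p\<bar> \<le> 9 / 20 * W\<^sup>2"
    using sigma_eq[of l] by (simp add: power2_eq_square)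
  have a: "W\<^sup>2 \<le> real n * p" unfolding W_sq using p by (intro mult_left_le) auto
  have b: "W\<^sup>2 \<le> real n * (1 - p)" unfolding W_sq using p
    by (intro mult_right_mono mult_left_le) auto
  have c: "0 \<le> W\<^sup>2" by simp
  note W_sq_ge
  show 1: "l \<le> n"
  proof -
    have "real n * (1 - p) = real n - real n * p" by (simp add: algebra_simps)
    hence "real l \<le> real n" using l b c by linarith
    thus ?thesis by simp
  qed
  show 2: "real n * p / 2 \<le> real l - real d" using l a c W_sq_ge by linarith
  show 3: "real n * (1 - p) / 2 \<le> real (n - l) - real d"
      proof -
    have "real n * (1 - p) = real n - real n * p" by (simp add: algebra_simps)
    thus ?thesis using l b c W_sq_ge 1 of_nat_diff[OF 1, where 'a = real] by linarith
  qed
  have "0 \<le> real n * p / 2" "0 \<le> real n * (1 - p) / 2" using p by auto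
  hence "real d \<le> real l" "real d \<le> real (n - l)" using 2 3 by linarith+
  thus "d \<le> l" "d \<le> n - l" by (simp_all only: of_nat_le_iff)
qed

text \<open>
The denominators \<open>n p / 2\<close> and \<open>n (1 - p) / 2\<close> combine because \<open>1 / (n p) + 1 / (n (1 - p)) = 1 / W^2\<close>.
\<close>

lemma one_minus_eigenvalue_near:
  assumes "near l" "near m" "l \<le> m"
  shows "1 - eigenvalue n l m d \<le> 2 * real d * (\<sigma> m - \<sigma> l) / W"
proof -
  note a = near_imp[OF assms(1)] and b = near_imp[OF assms(2)]
  have n0: "0 < real n" using a(1,2) d by simp
  have W0: "W > 0" using W_ge'(2) by simp
  have "1 - eigenvalue n l m d \<le> real d * (real m - real l) * (1 / (real n * p / 2) + 1 / (real n * (1 - p) / 2))"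
    using a b assms(3) p n0 by (intro one_minus_eigenvalue_le) auto
  also have "1 / (real n * p / 2) + 1 / (real n * (1 - p) / 2) = 2 / W\<^sup>2"
    unfolding W_sq using n0 p by (simp add: divide_simps)
  also have "real m - real l = (\<sigma> m - \<sigma> l) * W"
    using sigma_eq[of m] sigma_eq[of l] by (simp add: algebra_simps)
  also have "real d * ((\<sigma> m - \<sigma> l) * W) * (2 / W\<^sup>2) = 2 * real d * (\<sigma> m - \<sigma> l) / W"
    using W0 by (simp add: power2_eq_square)
  finally show ?thesis .
qed

lemma near_k: "i \<in> {1..d + 1} \<Longrightarrow> near (k i)"
  using k_M[of i] W_ge'(2,3) M unfolding near_def by linarith

lemma inj_k: "inj_on k {1..d + 1}"
  using k_sep eta(1) unfolding inj_on_def by force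

lemma diff_sigma: "\<bar>real a - real b\<bar> = \<bar>\<sigma> a - \<sigma> b\<bar> * W"
proof -
  have "real a - real b = (\<sigma> a - \<sigma> b) * W"
    using sigma_eq[of a] sigma_eq[of b] by (simp add: algebra_simps)
  thus ?thesis using W_ge'(2) by (simp add: abs_mult)
qed

lemma gamma_bound:
  assumes "i \<in> {1..d + 1}"
  shows "\<bar>\<gamma> l i\<bar> \<le> (M / \<eta> * (1 + \<bar>\<sigma> l\<bar>)) ^ d"
proof -
  have W0: "W > 0" using W_ge'(2) by simp
  have "\<bar>\<gamma> l i\<bar> \<le> (M * (1 + \<bar>\<sigma> l\<bar>) * W / (\<eta> * W)) ^ (card {1..d + 1} - 1)"
    unfolding \<gamma>_def
  proof (rule lagrange_coeff_bound)
    fix j assume j: "j \<in> {1..d + 1}" "j \<noteq> i"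
    have "\<bar>\<sigma> l\<bar> * 1 \<le> \<bar>\<sigma> l\<bar> * M" using M by (intro mult_left_mono) auto
    hence "\<bar>\<sigma> l - \<sigma> (k j)\<bar> \<le> M * (1 + \<bar>\<sigma> l\<bar>)"
      using k_M[OF j(1)] by (simp add: algebra_simps)
    thus "\<bar>real l - real (k j)\<bar> \<le> M * (1 + \<bar>\<sigma> l\<bar>) * W"
      unfolding diff_sigma using W0 by (intro mult_right_mono) auto
    show "\<eta> * W \<le> \<bar>real (k i) - real (k j)\<bar>"
      unfolding diff_sigma using W0 k_sep[OF assms j(1)] j(2) by (intro mult_right_mono) auto
  qed (use assms eta M W0 in auto)
  thus ?thesis using W0 by (simp add: mult_ac)
qed

text \<open>
Conditioning is done on the largest slice involved rather than on a fixed one, so that the distance to it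
is controlled by \<open>\<bar>\<sigma> l\<bar> + M\<close>.
\<close>

lemma top_slice:
  assumes "near l"
  obtains m where "near m" "l \<le> m" "\<And>i. i \<in> {1..d + 1} \<Longrightarrow> k i \<le> m" "\<sigma> m \<le> max (\<sigma> l) M"
proof -
  define m where "m = Max (insert l (k ` {1..d + 1}))"
  have "m \<in> insert l (k ` {1..d + 1})" unfolding m_def by (intro Max_in) auto
  then consider "m = l" | i where "i \<in> {1..d + 1}" "m = k i" by blast
  hence "near m \<and> \<sigma> m \<le> max (\<sigma> l) M"
  proof cases
    case 2
    thus ?thesis using near_k[OF 2(1)] k_M[OF 2(1)] by auto
  qed (use assms in auto)
  moreover have "l \<le> m" unfolding m_def by (intro Max_ge) auto
  moreover have "k i \<le> m" if "i \<in> {1..d + 1}" for i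
    unfolding m_def using that by (intro Max_ge) auto
  ultimately show ?thesis using that by blast
qed

text \<open>
Interpolate the conditional expectation from the given slices, where conditioning does not increase the
norm, and apply the Cauchy-Schwarz inequality.
\<close>

lemma projected_norm_bound:
  assumes c: "deg_less (Suc d) c" and Q1: "\<And>i. i \<in> {1..d + 1} \<Longrightarrow> Q c (k i) \<le> 1"
    and m: "m \<le> n" "\<And>i. i \<in> {1..d + 1} \<Longrightarrow> k i \<le> m"
    and b: "\<And>i. i \<in> {1..d + 1} \<Longrightarrow> \<bar>\<gamma> l i\<bar> \<le> b"
  shows "cross n m m (mlpoly n (down l m c)) (mlpoly n (down l m c)) \<le> (real (d + 1) * b)\<^sup>2"
proof -
  let ?I = "{1..d + 1}"
  define G where "G = (\<lambda>i \<pi>. mlpoly n (down (k i) m c) (slice_point \<pi> m))"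
  have G1: "perm_avg n (\<lambda>\<pi>. (G i \<pi>)\<^sup>2) \<le> 1" if "i \<in> ?I" for i
    using down_contraction[OF c m(2)[OF that] m(1)] Q1[OF that]
    by (simp add: G_def cross_def power2_eq_square)
  have b0: "0 \<le> b" using b[of 1] by auto
  have "cross n m m (mlpoly n (down l m c)) (mlpoly n (down l m c))
      = perm_avg n (\<lambda>\<pi>. (\<Sum>i\<in>?I. \<gamma> l i * G i \<pi>)\<^sup>2)"
    unfolding cross_def G_def \<gamma>_def power2_eq_square
    by (subst (1 2) down_interpolation[of ?I k c]) (use c inj_k in auto)
  also have "\<dots> \<le> perm_avg n (\<lambda>\<pi>. (\<Sum>i\<in>?I. (\<gamma> l i)\<^sup>2) * (\<Sum>i\<in>?I. (G i \<pi>)\<^sup>2))"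
    by (intro perm_avg_mono Cauchy_Schwarz_ineq_sum)
  also have "\<dots> = (\<Sum>i\<in>?I. (\<gamma> l i)\<^sup>2) * (\<Sum>i\<in>?I. perm_avg n (\<lambda>\<pi>. (G i \<pi>)\<^sup>2))"
    by (simp only: perm_avg_cmult perm_avg_sum)
  also have "\<dots> \<le> (\<Sum>i\<in>?I. b\<^sup>2) * (\<Sum>i\<in>?I. 1)"
    using b0 G1 b by (intro mult_mono sum_mono sum_nonneg perm_avg_nonneg) (auto intro!: power2_le_iff_abs_le[THEN iffD2])
  also have "\<dots> = (real (d + 1) * b)\<^sup>2" by (simp add: power2_eq_square algebra_simps)
  finally show ?thesis .
qed

text \<open>
The largest slice is at normalised distance at most \<open>2 M \<le> 2 W / (9 d)\<close>, so the eigenvalue is at least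
\<open>1 - 4/9\<close>, and a bound for the conditional expectation is one for the polynomial itself.
\<close>

lemma central_norm_bound:
  assumes c: "deg_less (Suc d) c" and Q1: "\<And>i. i \<in> {1..d + 1} \<Longrightarrow> Q c (k i) \<le> 1"
    and l: "\<bar>\<sigma> l\<bar> \<le> 1"
  shows "Q c l \<le> 9 / 5 * (real (d + 1) * (2 * M / \<eta>) ^ d)\<^sup>2"
proof -
  have nl: "near l" using l W_ge'(2) by (simp add: near_def)
  obtain m where m: "near m" "l \<le> m" "\<And>i. i \<in> {1..d + 1} \<Longrightarrow> k i \<le> m" "\<sigma> m \<le> max (\<sigma> l) M"
    using top_slice[OF nl] by metis
  have W0: "W > 0" using W_ge'(2) by simp
  have "1 - eigenvalue n l m d \<le> 2 * real d * (\<sigma> m - \<sigma> l) / W"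
    by (rule one_minus_eigenvalue_near[OF nl m(1,2)])
  also have "\<dots> \<le> 2 * real d * (2 * M) / W"
    using m(4) l M W0 by (intro divide_right_mono mult_left_mono) auto
  also have "\<dots> \<le> 4 / 9" using W_ge W0 by (simp add: divide_simps mult_ac)
  finally have ev: "5 / 9 \<le> eigenvalue n l m d" by simp
  have "5 / 9 * Q c l \<le> eigenvalue n l m d * Q c l"
    using ev cross_nonneg by (intro mult_right_mono)
  also have "\<dots> \<le> cross n m m (mlpoly n (down l m c)) (mlpoly n (down l m c))"
    using near_imp[OF nl] near_imp[OF m(1)] m(2) by (intro down_norm_lower c) auto
  also have "\<dots> \<le> (real (d + 1) * (2 * M / \<eta>) ^ d)\<^sup>2"
  proof (rule projected_norm_bound[OF c Q1])
    fix i assume i: "i \<in> {1..d + 1}"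
    have "(M / \<eta> * (1 + \<bar>\<sigma> l\<bar>)) ^ d \<le> (M / \<eta> * 2) ^ d"
      using l M eta by (intro power_mono mult_left_mono) auto
    thus "\<bar>\<gamma> l i\<bar> \<le> (2 * M / \<eta>) ^ d" using gamma_bound[OF i, of l] by (simp add: mult_ac)
  qed (use m near_imp in auto)
  finally show ?thesis by simp
qed

text \<open>
The base of the power in the final bound, up to absolute constants and the factor \<open>1 / (p (1 - p))\<close>.
\<close>

definition R :: real where "R = real d * M / \<eta>"

lemma R_ge: "1 \<le> R" "real d * M \<le> R"
proof -
  have "real d * M * \<eta> \<le> real d * M * 1" using M eta d by (intro mult_left_mono) auto
  thus "real d * M \<le> R" using eta by (simp add: R_def field_simps)
  moreover have "1 * 1 \<le> real d * M" using M d by (intro mult_mono) auto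
  ultimately show "1 \<le> R" by simp
qed

lemma d_bounds: "real (d + 1) \<le> 2 ^ d" "real (2 * d + 1) \<le> 3 ^ d"
proof -
  show "real (d + 1) \<le> 2 ^ d"
    using Bernoulli_inequality[of 1 d] by simp
  show "real (2 * d + 1) \<le> 3 ^ d"
    using Bernoulli_inequality[of "2 :: real" d] by (simp add: algebra_simps)
qed

text \<open>
The central nodes are \<open>2 d + 1\<close> integers with spacing about \<open>W / (3 d)\<close>, starting at \<open>\<lfloor>n p\<rfloor>\<close>, so that they
stay within one standard deviation of \<open>n p\<close>.
\<close>

definition step :: nat where "step = nat \<lfloor>W / (3 * real d)\<rfloor>"

definition node :: "nat \<Rightarrow> nat" where "node j = nat \<lfloor>real n * p\<rfloor> + j * step"

lemma step_bounds: "W / (5 * real d) \<le> real step" "real step \<le> W / (3 * real d)"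
proof -
  have d0: "real d > 0" using d by simp
  have W0: "W > 0" using W_ge'(2) by simp
  have r: "real step = of_int \<lfloor>W / (3 * real d)\<rfloor>"
    unfolding step_def using W0 d0 by simp
  show "real step \<le> W / (3 * real d)" unfolding r by linarith
  have "W / (5 * real d) + 1 \<le> W / (3 * real d)"
    using W_ge'(1) d0 by (simp add: divide_simps)
  thus "W / (5 * real d) \<le> real step" unfolding r by linarith
qed

lemma node_central:
  assumes "j \<le> 2 * d"
  shows "\<bar>\<sigma> (node j)\<bar> \<le> 1"
proof -
  have d0: "real d > 0" using d by simp
  have W0: "W > 0" using W_ge'(2) by simp
  have "real j * real step \<le> real (2 * d) * (W / (3 * real d))"
    using assms step_bounds by (intro mult_mono) auto
  also have "\<dots> = 2 / 3 * W" using d0 by simp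
  finally have a: "real j * real step \<le> 2 / 3 * W" .
  have "real (node j) = of_int \<lfloor>real n * p\<rfloor> + real j * real step"
    using p by (simp add: node_def)
  moreover have "real_of_int \<lfloor>real n * p\<rfloor> \<le> real n * p" "real n * p - 1 \<le> real_of_int \<lfloor>real n * p\<rfloor>"
    by linarith+
  moreover have "0 \<le> real j * real step" by simp
  ultimately have "\<bar>real (node j) - real n * p\<bar> \<le> W"
    using a W_ge'(2) by linarith
  hence "\<bar>\<sigma> (node j)\<bar> * W \<le> 1 * W"
    using sigma_eq[of "node j"] W0 by (simp add: abs_mult)
  thus ?thesis using W0 by (simp only: mult_le_cancel_right_pos)
qed

lemma node_sep:
  assumes "i \<noteq> j"
  shows "W / (5 * real d) \<le> \<bar>real (node i) - real (node j)\<bar>"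
proof -
  have "real (node i) - real (node j) = (real i - real j) * real step"
    by (simp add: node_def algebra_simps)
  moreover have "1 \<le> \<bar>real i - real j\<bar>" using assms by linarith
  hence "1 * real step \<le> \<bar>real i - real j\<bar> * real step" by (intro mult_right_mono) auto
  ultimately show ?thesis using step_bounds(1) by (simp add: abs_mult)
qed

text \<open>
Extrapolation of the squared norm, which has degree \<open>2 d\<close> in \<open>l\<close>, from the central nodes.
\<close>

lemma norm_bound:
  assumes c: "deg_less (Suc d) c" and Q1: "\<And>i. i \<in> {1..d + 1} \<Longrightarrow> Q c (k i) \<le> 1"
    and l: "l \<le> n"
  shows "Q c l \<le> (2 * (60 * R * (1 + \<bar>\<sigma> l\<bar>)) ^ d)\<^sup>2"
proof -
  let ?J = "{..2 * d}"
  let ?B = "9 / 5 * (real (d + 1) * (2 * M / \<eta>) ^ d)\<^sup>2"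
  let ?t = "1 + \<bar>\<sigma> l\<bar>"
  have d0: "real d > 0" using d by simp
  have W0: "W > 0" using W_ge'(2) by simp
  have M0: "M > 0" using M by simp
  have node_le: "node j \<le> n" if "j \<in> ?J" for j
  proof -
    have "near (node j)" using node_central[of j] that W_ge'(2) by (simp add: near_def)
    thus ?thesis by (rule near_imp)
  qed
  have inj: "inj_on node ?J"
  proof (rule inj_onI)
    fix i j assume "node i = node j"
    moreover have "0 < W / (5 * real d)" using W0 d0 by simp
    ultimately show "i = j" using node_sep[of i j] by force
  qed
  have L: "\<bar>lagrange_coeff ?J (\<lambda>j. real (node j)) j (real l)\<bar> \<le> (5 * real d * ?t) ^ (2 * d)" if j: "j \<in> ?J" for j
  proof -
    have "\<bar>lagrange_coeff ?J (\<lambda>j. real (node j)) j (real l)\<bar> \<le> (?t * W / (W / (5 * real d))) ^ (card ?J - 1)"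
    proof (rule lagrange_coeff_bound)
      fix i assume i: "i \<in> ?J" "i \<noteq> j"
      have "\<bar>\<sigma> l - \<sigma> (node i)\<bar> \<le> ?t" using node_central[of i] i by simp
      thus "\<bar>real l - real (node i)\<bar> \<le> ?t * W"
        unfolding diff_sigma using W0 by (intro mult_right_mono) auto
      show "W / (5 * real d) \<le> \<bar>real (node j) - real (node i)\<bar>" using node_sep i by simp
    qed (use j W0 d0 in auto)
    also have "?t * W / (W / (5 * real d)) = 5 * real d * ?t" using W0 by simp
    finally show ?thesis by simp
  qed
  have "Q c l = (\<Sum>j\<in>?J. lagrange_coeff ?J (\<lambda>j. real (node j)) j (real l) * Q c (node j))"
    using node_le by (intro cross_interpolation[OF _ inj _ c l]) auto
  also have "\<dots> \<le> (\<Sum>j\<in>?J. (5 * real d * ?t) ^ (2 * d) * ?B)"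
  proof (intro sum_mono)
    fix j assume j: "j \<in> ?J"
    have "lagrange_coeff ?J (\<lambda>j. real (node j)) j (real l) * Q c (node j)
        \<le> \<bar>lagrange_coeff ?J (\<lambda>j. real (node j)) j (real l)\<bar> * Q c (node j)"
      by (intro mult_right_mono cross_nonneg) simp
    also have "\<dots> \<le> (5 * real d * ?t) ^ (2 * d) * ?B"
      using j by (intro mult_mono L central_norm_bound[OF c Q1] node_central cross_nonneg) auto
    finally show "lagrange_coeff ?J (\<lambda>j. real (node j)) j (real l) * Q c (node j) \<le> (5 * real d * ?t) ^ (2 * d) * ?B" .
  qed
  also have "\<dots> = real (2 * d + 1) * ((5 * real d * ?t) ^ (2 * d) * ?B)"
    by simp
  also have "\<dots> \<le> 3 ^ d * ((5 * real d * ?t) ^ (2 * d) * (9 / 5 * (2 ^ d * (2 * M / \<eta>) ^ d)\<^sup>2))"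
  proof -
    have "real (d + 1) * (2 * M / \<eta>) ^ d \<le> 2 ^ d * (2 * M / \<eta>) ^ d"
      using d_bounds(1) M0 eta by (intro mult_right_mono) auto
    hence "(real (d + 1) * (2 * M / \<eta>) ^ d)\<^sup>2 \<le> (2 ^ d * (2 * M / \<eta>) ^ d)\<^sup>2"
      using M0 eta by (intro power_mono) auto
    hence "(5 * real d * ?t) ^ (2 * d) * ?B \<le> (5 * real d * ?t) ^ (2 * d) * (9 / 5 * (2 ^ d * (2 * M / \<eta>) ^ d)\<^sup>2)"
      by (intro mult_left_mono) auto
    thus ?thesis by (rule mult_mono[OF d_bounds(2)]) auto
  qed
  also have "\<dots> = 9 / 5 * (3 ^ d * ((20 * R * ?t) ^ d)\<^sup>2)"
  proof -
    have "20 * R * ?t = 5 * real d * ?t * (2 * (2 * M / \<eta>))" by (simp add: R_def)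
    hence "(20 * R * ?t) ^ d = (5 * real d * ?t) ^ d * (2 ^ d * (2 * M / \<eta>) ^ d)"
      by (simp only: power_mult_distrib)
    hence "((20 * R * ?t) ^ d)\<^sup>2 = (5 * real d * ?t) ^ (2 * d) * (2 ^ d * (2 * M / \<eta>) ^ d)\<^sup>2"
      by (simp only: power_mult_distrib[of _ _ 2] power_even_eq)
    thus ?thesis by (simp only: mult.left_commute mult.commute)
  qed
  also have "\<dots> \<le> 4 * (9 ^ d * ((20 * R * ?t) ^ d)\<^sup>2)"
  proof -
    have "(3::real) ^ d \<le> 9 ^ d" by (intro power_mono) auto
    hence "3 ^ d * ((20 * R * ?t) ^ d)\<^sup>2 \<le> 9 ^ d * ((20 * R * ?t) ^ d)\<^sup>2"
      by (intro mult_right_mono) auto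
    moreover have "0 \<le> 9 ^ d * ((20 * R * ?t) ^ d)\<^sup>2" by simp
    ultimately show ?thesis by linarith
  qed
  also have "\<dots> = (2 * (60 * R * ?t) ^ d)\<^sup>2"
  proof -
    have "60 * R * ?t = 3 * (20 * R * ?t)" by simp
    hence "(60 * R * ?t) ^ d = 3 ^ d * (20 * R * ?t) ^ d"
      by (simp only: power_mult_distrib)
    moreover have "(9::real) ^ d = (3 ^ d)\<^sup>2"
      by (simp add: power2_eq_square flip: power_mult_distrib)
    ultimately show ?thesis by (simp only: power_mult_distrib[of _ _ 2]) simp
  qed
  finally show ?thesis .
qed

text \<open>
The mean distance is at most the root mean square distance, and the latter is controlled by the deviation
of the eigenvalue from 1.
\<close>

lemma slice_error:
  assumes c: "deg_less (Suc d) c" and l: "near l" "near m" "l \<le> m" and t: "\<sigma> m - \<sigma> l \<le> 2 * M * t"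
  shows "perm_avg n (\<lambda>\<pi>. \<bar>mlpoly n c (slice_point \<pi> l) - mlpoly n (down l m c) (slice_point \<pi> m)\<bar>)
    \<le> sqrt (4 * real d * M * t / W) * sqrt (Q c l)"
proof -
  have W0: "W > 0" using W_ge'(2) by simp
  have "perm_avg n (\<lambda>\<pi>. (mlpoly n c (slice_point \<pi> l) - mlpoly n (down l m c) (slice_point \<pi> m))\<^sup>2)
    \<le> (1 - eigenvalue n l m d) * Q c l"
    using near_imp[OF l(1)] near_imp[OF l(2)] l(3) by (intro down_distance_le c) auto
  also have "\<dots> \<le> (4 * real d * M * t / W) * Q c l"
  proof (intro mult_right_mono cross_nonneg)
    have "2 * real d * (\<sigma> m - \<sigma> l) / W \<le> 2 * real d * (2 * M * t) / W"
      using t W0 by (intro divide_right_mono mult_left_mono) auto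
    thus "1 - eigenvalue n l m d \<le> 4 * real d * M * t / W"
      using one_minus_eigenvalue_near[OF l] by (simp add: mult_ac)
  qed
  finally show ?thesis
    by (intro order.trans[OF perm_avg_abs_le_sqrt]) (simp flip: real_sqrt_mult)
qed

text \<open>
The interpolation formula is exact for the conditional expectations given the largest slice; each of the
\<open>d + 2\<close> values of \<open>f\<close> is replaced by its conditional expectation at the cost of \<open>slice_error\<close>.
\<close>

lemma interpolation_error:
  assumes c: "deg_less (Suc d) c" and Q1: "\<And>i. i \<in> {1..d + 1} \<Longrightarrow> Q c (k i) \<le> 1"
    and l: "near l"
  shows "perm_avg n (\<lambda>\<pi>. \<bar>mlpoly n c (slice_point \<pi> l) - (\<Sum>i\<in>{1..d + 1}. \<gamma> l i * mlpoly n c (slice_point \<pi> (k i)))\<bar>)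
    \<le> 6 * R * (60 * R) ^ d * (1 + \<bar>\<sigma> l\<bar>) ^ (d + 1) / sqrt W"
proof -
  let ?I = "{1..d + 1}"
  let ?t = "1 + \<bar>\<sigma> l\<bar>"
  have W0: "W > 0" using W_ge'(2) by simp
  obtain m where m: "near m" "l \<le> m" "\<And>i. i \<in> {1..d + 1} \<Longrightarrow> k i \<le> m" "\<sigma> m \<le> max (\<sigma> l) M"
    using top_slice[OF l] by metis
  define F where "F = (\<lambda>l \<pi>. mlpoly n c (slice_point \<pi> l))"
  define G where "G = (\<lambda>l \<pi>. mlpoly n (down l m c) (slice_point \<pi> m))"
  define e where "e = sqrt (4 * real d * M * ?t / W)"
  have e0: "0 \<le> e" using M W0 by (simp add: e_def)
  have Mt: "\<bar>\<sigma> l\<bar> * 1 \<le> \<bar>\<sigma> l\<bar> * M" using M by (intro mult_left_mono) auto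
  have err_l: "perm_avg n (\<lambda>\<pi>. \<bar>F l \<pi> - G l \<pi>\<bar>) \<le> e * sqrt (Q c l)"
    unfolding F_def G_def e_def
    using Mt M m(4) by (intro slice_error[OF c l m(1,2)]) (simp add: algebra_simps)
  have err_k: "perm_avg n (\<lambda>\<pi>. \<bar>F (k i) \<pi> - G (k i) \<pi>\<bar>) \<le> e" if i: "i \<in> ?I" for i
  proof -
    have "perm_avg n (\<lambda>\<pi>. \<bar>F (k i) \<pi> - G (k i) \<pi>\<bar>) \<le> e * sqrt (Q c (k i))"
      unfolding F_def G_def e_def
      using Mt M m(4) k_M[OF i] by (intro slice_error[OF c near_k[OF i] m(1) m(3)[OF i]]) (simp add: algebra_simps)
    also have "\<dots> \<le> e * 1" using e0 Q1[OF i] by (intro mult_left_mono) auto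
    finally show ?thesis by simp
  qed
  have G: "G l \<pi> = (\<Sum>i\<in>?I. \<gamma> l i * G (k i) \<pi>)" for \<pi>
    unfolding G_def \<gamma>_def by (rule down_interpolation) (use c inj_k in auto)
  have "perm_avg n (\<lambda>\<pi>. \<bar>F l \<pi> - (\<Sum>i\<in>?I. \<gamma> l i * F (k i) \<pi>)\<bar>)
     \<le> perm_avg n (\<lambda>\<pi>. \<bar>F l \<pi> - G l \<pi>\<bar> + (\<Sum>i\<in>?I. \<bar>\<gamma> l i\<bar> * \<bar>F (k i) \<pi> - G (k i) \<pi>\<bar>))"
  proof (rule perm_avg_mono)
    fix \<pi>
    have "F l \<pi> - (\<Sum>i\<in>?I. \<gamma> l i * F (k i) \<pi>) = (F l \<pi> - G l \<pi>) - (\<Sum>i\<in>?I. \<gamma> l i * (F (k i) \<pi> - G (k i) \<pi>))"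
      unfolding G by (simp add: right_diff_distrib sum_subtractf)
    moreover have "\<bar>\<Sum>i\<in>?I. \<gamma> l i * (F (k i) \<pi> - G (k i) \<pi>)\<bar> \<le> (\<Sum>i\<in>?I. \<bar>\<gamma> l i\<bar> * \<bar>F (k i) \<pi> - G (k i) \<pi>\<bar>)"
      by (rule order.trans[OF sum_abs]) (simp only: abs_mult order.refl)
    ultimately show "\<bar>F l \<pi> - (\<Sum>i\<in>?I. \<gamma> l i * F (k i) \<pi>)\<bar> \<le> \<bar>F l \<pi> - G l \<pi>\<bar> + (\<Sum>i\<in>?I. \<bar>\<gamma> l i\<bar> * \<bar>F (k i) \<pi> - G (k i) \<pi>\<bar>)"
      by linarith
  qed
  also have "\<dots> = perm_avg n (\<lambda>\<pi>. \<bar>F l \<pi> - G l \<pi>\<bar>) + (\<Sum>i\<in>?I. \<bar>\<gamma> l i\<bar> * perm_avg n (\<lambda>\<pi>. \<bar>F (k i) \<pi> - G (k i) \<pi>\<bar>))"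
    by (simp only: perm_avg_add perm_avg_sum perm_avg_cmult)
  also have "\<dots> \<le> e * sqrt (Q c l) + (\<Sum>i\<in>?I. (M / \<eta> * ?t) ^ d * e)"
    using M eta by (intro add_mono err_l sum_mono mult_mono err_k gamma_bound) (auto intro!: perm_avg_nonneg)
  also have "\<dots> = e * (sqrt (Q c l) + real (d + 1) * (M / \<eta> * ?t) ^ d)"
    by (simp add: algebra_simps)
  also have "\<dots> \<le> e * (2 * (60 * R * ?t) ^ d + (60 * R * ?t) ^ d)"
  proof (intro mult_left_mono add_mono e0)
    show "sqrt (Q c l) \<le> 2 * (60 * R * ?t) ^ d"
      using norm_bound[OF c Q1 near_imp(1)[OF l]] R_ge by (intro real_le_lsqrt) auto
    have "real (d + 1) * (M / \<eta> * ?t) ^ d \<le> 2 ^ d * (M / \<eta> * ?t) ^ d"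
      using d_bounds M eta by (intro mult_right_mono) auto
    also have "\<dots> = (2 * (M / \<eta>) * ?t) ^ d" by (simp only: power_mult_distrib mult.assoc)
    also have "\<dots> \<le> (60 * R * ?t) ^ d"
    proof (intro power_mono mult_right_mono mult_mono)
      have "1 * (M / \<eta>) \<le> real d * (M / \<eta>)" using d M eta by (intro mult_right_mono) auto
      thus "M / \<eta> \<le> R" by (simp add: R_def)
    qed (use M eta in auto)
    finally show "real (d + 1) * (M / \<eta> * ?t) ^ d \<le> (60 * R * ?t) ^ d" .
  qed
  also have "\<dots> = e * (3 * (60 * R * ?t) ^ d)" by simp
  also have "\<dots> \<le> (2 * R * ?t / sqrt W) * (3 * (60 * R * ?t) ^ d)"
  proof (intro mult_right_mono)
    have "4 * real d * M * ?t \<le> 4 * (R * ?t)"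
      using mult_right_mono[OF R_ge(2), of ?t] by (simp add: mult.assoc)
    also have "R * ?t * 1 \<le> (R * ?t) * (R * ?t)"
    proof (intro mult_left_mono)
      have "1 * 1 \<le> R * ?t" using R_ge by (intro mult_mono) auto
      thus "1 \<le> R * ?t" by simp
    qed (use R_ge in auto)
    hence "4 * (R * ?t) \<le> (2 * R * ?t)\<^sup>2" by (simp add: power2_eq_square)
    finally have "sqrt (4 * real d * M * ?t) \<le> 2 * R * ?t"
      using R_ge by (intro real_le_lsqrt) auto
    thus "e \<le> 2 * R * ?t / sqrt W"
      unfolding e_def real_sqrt_divide using W0 by (intro divide_right_mono) auto
  qed (use R_ge in auto)
  also have "\<dots> = 6 * R * (60 * R) ^ d * ?t ^ (d + 1) / sqrt W"
    by (simp add: power_mult_distrib)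
  finally show ?thesis by (simp add: F_def)
qed

section \<open>Moments and tails of the slice index\<close>

abbreviation bw :: "nat \<Rightarrow> real" where "bw \<equiv> bin_weight n p"

lemma bw_nonneg: "0 \<le> bw l"
  using p by (simp add: bin_weight_nonneg)

lemma sigma_mgf:
  assumes "\<bar>\<theta>\<bar> \<le> W"
  shows "(\<Sum>l\<le>n. bw l * exp (\<theta> * \<sigma> l)) \<le> exp (\<theta>\<^sup>2)"
proof -
  have W0: "W > 0" using W_ge'(2) by simp
  have "\<theta> * \<sigma> l = (\<theta> / W) * (real l - real n * p)" for l
    by (simp add: sigma_dev_def W_def)
  hence "(\<Sum>l\<le>n. bw l * exp (\<theta> * \<sigma> l)) \<le> exp ((\<theta> / W)\<^sup>2 * (real n * p * (1 - p)))"
    using assms W0 p by (simp only:) (intro binomial_mgf, auto)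
  also have "(\<theta> / W)\<^sup>2 * (real n * p * (1 - p)) = \<theta>\<^sup>2"
    unfolding W_sq[symmetric] using W0 by (simp add: power_divide)
  finally show ?thesis .
qed

lemma abs_sigma_mgf:
  assumes "0 \<le> \<theta>" "\<theta> \<le> W"
  shows "(\<Sum>l\<le>n. bw l * exp (\<theta> * \<bar>\<sigma> l\<bar>)) \<le> 2 * exp (\<theta>\<^sup>2)"
proof -
  have "(\<Sum>l\<le>n. bw l * exp (\<theta> * \<bar>\<sigma> l\<bar>)) \<le> (\<Sum>l\<le>n. bw l * exp (\<theta> * \<sigma> l) + bw l * exp (- \<theta> * \<sigma> l))"
    unfolding distrib_left[symmetric]
    by (intro sum_mono mult_left_mono bw_nonneg) (auto simp: abs_if)
  also have "\<dots> \<le> exp (\<theta>\<^sup>2) + exp ((- \<theta>)\<^sup>2)"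
    unfolding sum.distrib using assms by (intro add_mono sigma_mgf) auto
  finally show ?thesis by simp
qed

text \<open>
Markov's inequality with the weight \<open>exp (b (\<bar>\<sigma> l\<bar> - s))\<close>.
\<close>

lemma tail_mgf:
  assumes "0 \<le> a" "0 \<le> b" "a + b \<le> W"
  shows "(\<Sum>l\<in>{l\<in>{..n}. s < \<bar>\<sigma> l\<bar>}. bw l * exp (a * \<bar>\<sigma> l\<bar>)) \<le> 2 * exp ((a + b)\<^sup>2 - b * s)"
proof -
  have "(\<Sum>l\<in>{l\<in>{..n}. s < \<bar>\<sigma> l\<bar>}. bw l * exp (a * \<bar>\<sigma> l\<bar>))
      \<le> (\<Sum>l\<in>{l\<in>{..n}. s < \<bar>\<sigma> l\<bar>}. bw l * exp ((a + b) * \<bar>\<sigma> l\<bar>) * exp (- b * s))"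
  proof (intro sum_mono)
    fix l assume l: "l \<in> {l\<in>{..n}. s < \<bar>\<sigma> l\<bar>}"
    have "b * s \<le> b * \<bar>\<sigma> l\<bar>" using l assms by (intro mult_left_mono) auto
    hence "exp (a * \<bar>\<sigma> l\<bar>) \<le> exp ((a + b) * \<bar>\<sigma> l\<bar> + - b * s)" by (simp add: algebra_simps)
    also have "\<dots> = exp ((a + b) * \<bar>\<sigma> l\<bar>) * exp (- b * s)" by (rule exp_add)
    finally have "bw l * exp (a * \<bar>\<sigma> l\<bar>) \<le> bw l * (exp ((a + b) * \<bar>\<sigma> l\<bar>) * exp (- b * s))"
      by (intro mult_left_mono bw_nonneg)
    thus "bw l * exp (a * \<bar>\<sigma> l\<bar>) \<le> bw l * exp ((a + b) * \<bar>\<sigma> l\<bar>) * exp (- b * s)" by (simp add: mult.assoc)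
  qed
  also have "\<dots> \<le> (\<Sum>l\<le>n. bw l * exp ((a + b) * \<bar>\<sigma> l\<bar>) * exp (- b * s))"
    by (intro sum_mono2) (auto intro!: mult_nonneg_nonneg bw_nonneg)
  also have "\<dots> = (\<Sum>l\<le>n. bw l * exp ((a + b) * \<bar>\<sigma> l\<bar>)) * exp (- b * s)"
    by (simp add: sum_distrib_right)
  also have "\<dots> \<le> 2 * exp ((a + b)\<^sup>2) * exp (- b * s)"
    using assms by (intro mult_right_mono abs_sigma_mgf) auto
  also have "\<dots> = 2 * exp ((a + b)\<^sup>2 - b * s)" by (simp add: exp_diff exp_minus field_simps)
  finally show ?thesis .
qed

definition cutoff :: real where "cutoff = sqrt (3 * ln (W\<^sup>2))"

lemma cutoff_sq: "cutoff\<^sup>2 = 6 * ln W"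
proof -
  have "0 \<le> ln W" using W_ge'(2) by simp
  thus ?thesis using W_ge'(2) by (simp add: cutoff_def ln_realpow)
qed

lemma cutoff_ge: "3 \<le> cutoff" "12 \<le> cutoff\<^sup>2"
proof -
  have "exp 2 = exp (1::real) * exp 1" by (simp flip: exp_add)
  also have "\<dots> \<le> 3 * 3" using exp_le by (intro mult_mono) auto
  finally have "exp 2 \<le> W" using W_ge'(2) by simp
  hence "ln (exp 2) \<le> ln W" using W_ge'(2) by (subst ln_le_cancel_iff) auto
  thus 1: "12 \<le> cutoff\<^sup>2" unfolding cutoff_sq by simp
  have "0 \<le> cutoff" unfolding cutoff_def using W_ge'(2) by simp
  moreover have "3\<^sup>2 \<le> cutoff\<^sup>2" using 1 by simp
  ultimately show "3 \<le> cutoff" by (rule power2_le_imp_le[rotated])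
qed

text \<open>
Since \<open>cutoff^2 = 6 ln W\<close>, it suffices to bound the logarithm by its tangent at \<open>9\<close>, using \<open>ln 9 \<le> 5/2\<close>.
\<close>

lemma cutoff_near: "cutoff \<le> 9 / 20 * W"
proof -
  have W: "9 \<le> W" by (rule W_ge'(2))
  have e: "(5 / 2 :: real) \<le> exp 1" using exp_lower_Taylor_quadratic[of 1] by simp
  hence "9 \<le> exp (5 / 2 :: real)"
  proof -
    have "(exp (5 / 2 :: real))\<^sup>2 = exp (real 2 * (5 / 2))" by (rule exp_of_nat_mult[symmetric])
    also have "real 2 * (5 / 2) = real 5 * 1" by simp
    also have "exp \<dots> = exp (1::real) ^ 5" by (rule exp_of_nat_mult)
    finally have "(exp (5 / 2 :: real))\<^sup>2 = exp 1 ^ 5" .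
    moreover have "(5 / 2) ^ 5 \<le> exp (1::real) ^ 5" using e by (rule power_mono) simp
    moreover have "(9::real)\<^sup>2 \<le> (5 / 2) ^ 5" by (simp add: power_divide)
    ultimately have "9\<^sup>2 \<le> (exp (5 / 2 :: real))\<^sup>2" by linarith
    thus ?thesis by (rule power2_le_imp_le) (rule exp_ge_zero)
  qed
  hence "ln 9 \<le> ln (exp (5 / 2 :: real))" by (rule ln_mono[rotated 2]) simp_all
  hence l9: "ln 9 \<le> (5 / 2 :: real)" by simp
  have "ln W = ln 9 + ln (W / 9)" using W by (simp add: ln_div)
  also have "ln (W / 9) \<le> W / 9 - 1" using W by (intro ln_le_minus_one) auto
  finally have lnW: "ln W \<le> W / 9 + 3 / 2" using l9 by simp
  have "cutoff\<^sup>2 \<le> 6 * (W / 9 + 3 / 2)" unfolding cutoff_sq using lnW by simp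
  also have "\<dots> \<le> (9 / 20 * W)\<^sup>2"
  proof -
    have "9 * W \<le> W * W" using W by (intro mult_right_mono) auto
    hence "(81 / 400) * (9 * W) \<le> (81 / 400) * (W * W)" by simp
    moreover have "6 * (W / 9 + 3 / 2) \<le> (81 / 400) * (9 * W)" using W by simp
    moreover have "(9 / 20 * W)\<^sup>2 = (81 / 400) * (W * W)" by (simp add: power2_eq_square)
    ultimately show ?thesis by linarith
  qed
  finally show ?thesis by (rule power2_le_imp_le) (use W in simp)
qed

lemma exp_cutoff: "exp (- cutoff\<^sup>2 / 12) = 1 / sqrt W"
proof -
  have W0: "W > 0" using W_ge'(2) by simp
  have "- cutoff\<^sup>2 / 12 = - ln (sqrt W)" unfolding cutoff_sq using W0 by (simp add: ln_sqrt)
  thus ?thesis using W0 by (simp add: exp_minus inverse_eq_divide)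
qed

lemma tail_probability:
  defines "T \<equiv> {l\<in>{..n}. cutoff < \<bar>\<sigma> l\<bar>}"
  shows "(\<Sum>l\<in>T. bw l) \<le> 2 / sqrt W" "(\<Sum>l\<in>T. bw l) \<le> 1 / 2"
proof -
  have "(\<Sum>l\<in>T. bw l * exp (0 * \<bar>\<sigma> l\<bar>)) \<le> 2 * exp ((0 + cutoff / 2)\<^sup>2 - cutoff / 2 * cutoff)"
    unfolding T_def using cutoff_near cutoff_ge W_ge'(2) by (intro tail_mgf) auto
  also have "(0 + cutoff / 2)\<^sup>2 - cutoff / 2 * cutoff = - cutoff\<^sup>2 / 4" by (simp add: power2_eq_square)
  finally have *: "(\<Sum>l\<in>T. bw l) \<le> 2 * exp (- cutoff\<^sup>2 / 4)" by simp
  have "exp (- cutoff\<^sup>2 / 4) \<le> exp (- cutoff\<^sup>2 / 12)" by simp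
  thus "(\<Sum>l\<in>T. bw l) \<le> 2 / sqrt W" using * unfolding exp_cutoff by linarith
  have "exp (- cutoff\<^sup>2 / 4) \<le> exp (- 3)" using cutoff_ge(2) by simp
  moreover have "4 \<le> exp (3::real)" by (rule order.trans[OF _ exp_ge_add_one_self]) simp
  hence "exp (- 3 :: real) \<le> 1 / 4" by (simp add: exp_minus field_simps)
  ultimately show "(\<Sum>l\<in>T. bw l) \<le> 1 / 2" using * by linarith
qed

lemma one_plus_sigma_power: "(1 + \<bar>\<sigma> l\<bar>) ^ j \<le> 3 * fact j * exp (1 * \<bar>\<sigma> l\<bar>)"
proof -
  have "(1 + \<bar>\<sigma> l\<bar>) ^ j \<le> fact j * exp (1 + \<bar>\<sigma> l\<bar>)" by (rule power_le_fact_exp) simp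
  also have "\<dots> = fact j * (exp 1 * exp \<bar>\<sigma> l\<bar>)" by (simp add: exp_add)
  also have "\<dots> \<le> fact j * (3 * exp \<bar>\<sigma> l\<bar>)"
    using exp_le by (intro mult_left_mono mult_right_mono) auto
  finally show ?thesis by (simp add: mult_ac)
qed

lemma sigma_moment: "(\<Sum>l\<le>n. bw l * (1 + \<bar>\<sigma> l\<bar>) ^ j) \<le> 18 * fact j"
proof -
  have "(\<Sum>l\<le>n. bw l * (1 + \<bar>\<sigma> l\<bar>) ^ j) \<le> (\<Sum>l\<le>n. bw l * (3 * fact j * exp (1 * \<bar>\<sigma> l\<bar>)))"
    by (intro sum_mono mult_left_mono one_plus_sigma_power bw_nonneg)
  also have "\<dots> = 3 * fact j * (\<Sum>l\<le>n. bw l * exp (1 * \<bar>\<sigma> l\<bar>))"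
    by (simp add: sum_distrib_left mult_ac)
  also have "\<dots> \<le> 3 * fact j * (2 * exp (1\<^sup>2))"
    using W_ge'(2) by (intro mult_left_mono abs_sigma_mgf) auto
  also have "\<dots> \<le> 3 * fact j * (2 * 3)" using exp_le by (intro mult_left_mono) auto
  finally show ?thesis by simp
qed

text \<open>
The parameter \<open>b = cutoff / 2 - 1\<close> minimises the exponent in \<open>tail_mgf\<close> for \<open>a = 1\<close>.  The resulting
Gaussian-type bound is weakened to \<open>exp (- cutoff^2 / 12)\<close>, which is exactly \<open>1 / sqrt W = V^(-1/4)\<close>.
\<close>

lemma sigma_tail_moment:
  "(\<Sum>l\<in>{l\<in>{..n}. cutoff < \<bar>\<sigma> l\<bar>}. bw l * (1 + \<bar>\<sigma> l\<bar>) ^ j) \<le> 54 * fact j / sqrt W"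
proof -
  let ?T = "{l\<in>{..n}. cutoff < \<bar>\<sigma> l\<bar>}"
  have W0: "W > 0" using W_ge'(2) by simp
  have "(\<Sum>l\<in>?T. bw l * (1 + \<bar>\<sigma> l\<bar>) ^ j) \<le> (\<Sum>l\<in>?T. bw l * (3 * fact j * exp (1 * \<bar>\<sigma> l\<bar>)))"
    by (intro sum_mono mult_left_mono one_plus_sigma_power bw_nonneg)
  also have "\<dots> = 3 * fact j * (\<Sum>l\<in>?T. bw l * exp (1 * \<bar>\<sigma> l\<bar>))"
    by (simp add: sum_distrib_left mult_ac)
  also have "\<dots> \<le> 3 * fact j * (2 * exp ((1 + (cutoff / 2 - 1))\<^sup>2 - (cutoff / 2 - 1) * cutoff))"
    using cutoff_ge cutoff_near W0 by (intro mult_left_mono tail_mgf) auto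
  also have "(1 + (cutoff / 2 - 1))\<^sup>2 - (cutoff / 2 - 1) * cutoff = - cutoff\<^sup>2 / 12 + (3 / 2 - (cutoff - 3)\<^sup>2 / 6)"
    by (simp add: power2_eq_square field_simps)
  also have "3 * fact j * (2 * exp \<dots>) \<le> 3 * fact j * (2 * (1 / sqrt W * 9))"
  proof (intro mult_left_mono)
    have "exp (3 / 2 - (cutoff - 3)\<^sup>2 / 6) \<le> exp (2 :: real)" 
    proof -
      have "0 \<le> (cutoff - 3)\<^sup>2" by simp
      hence "3 / 2 - (cutoff - 3)\<^sup>2 / 6 \<le> 2" by linarith
      thus ?thesis by simp
    qed
    also have "exp 2 = exp (1::real) * exp 1" by (simp flip: exp_add)
    also have "\<dots> \<le> 3 * 3" using exp_le by (intro mult_mono) auto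
    finally show "exp (- cutoff\<^sup>2 / 12 + (3 / 2 - (cutoff - 3)\<^sup>2 / 6)) \<le> 1 / sqrt W * 9"
      unfolding exp_add exp_cutoff using W0 by (intro mult_left_mono) auto
  qed auto
  finally show ?thesis by simp
qed

section \<open>Averaging over the slices\<close>

text \<open>
A single power \<open>(200 R)^(4 d)\<close> absorbs the constants of the three error terms and the factorial from the
moments of the slice index.
\<close>

lemma constants_bound: "468 * R * (60 * R) ^ d * fact (d + 1) \<le> (200 * R) ^ (4 * d)"
proof -
  have R1: "1 \<le> R" by (rule R_ge)
  have "real d * 1 \<le> real d * M" using M by (intro mult_left_mono) auto
  hence dR: "real d \<le> R" using R_ge(2) by simp
  have "fact (d + 1) \<le> real ((d + 1) ^ (d + 1))"
    by (rule fact_le_power)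
  also have "\<dots> = real (d + 1) ^ (d + 1)" by (rule of_nat_power)
  also have "\<dots> \<le> (2 * R) ^ (d + 1)" using dR R1 by (intro power_mono) auto
  also have "\<dots> \<le> (2 * R) ^ (2 * d)" using R1 d by (intro power_increasing) auto
  also have "\<dots> = ((2 * R)\<^sup>2) ^ d" by (rule power_mult)
  also have "(2 * R)\<^sup>2 = 4 * R * R" by (simp add: power2_eq_square)
  finally have f: "fact (d + 1) \<le> (4 * R * R) ^ d" .
  have "468 * R \<le> (468 * R) ^ d" using R1 d by (intro self_le_power) auto
  hence "468 * R * (60 * R) ^ d \<le> (468 * R) ^ d * (60 * R) ^ d"
    using R1 by (intro mult_right_mono zero_le_power) auto
  hence "468 * R * (60 * R) ^ d * fact (d + 1) \<le> (468 * R) ^ d * (60 * R) ^ d * (4 * R * R) ^ d"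
    using f R1 by (intro mult_mono[OF _ f] mult_nonneg_nonneg zero_le_power) auto
  also have "\<dots> = (468 * R * (60 * R) * (4 * R * R)) ^ d" by (simp only: power_mult_distrib)
  also have "\<dots> \<le> ((200 * R) ^ 4) ^ d"
  proof (intro power_mono)
    have "468 * R * (60 * R) * (4 * R * R) = 112320 * R ^ 4" by (simp add: power4_eq_xxxx)
    also have "\<dots> \<le> 1600000000 * R ^ 4" by simp
    also have "\<dots> = (200 * R) ^ 4" by (simp add: power_mult_distrib)
    finally show "468 * R * (60 * R) * (4 * R * R) \<le> (200 * R) ^ 4" .
  qed (use R1 in auto)
  finally show ?thesis by (simp only: power_mult)
qed

text \<open>
After subtracting \<open>\<phi> 0\<close>, the difference of the two expectations splits into three sums over \<open>l\<close>: the tail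
of the binomial distribution, the change of normalisation caused by conditioning, and the interpolation
error inside the truncation window.
\<close>

lemma lipschitz_expectation_bound:
  assumes c: "deg_less (Suc d) c" and Q1: "\<And>i. i \<in> {1..d + 1} \<Longrightarrow> Q c (k i) \<le> 1"
    and \<phi>: "1-lipschitz_on UNIV \<phi>"
  shows "\<bar>measure_pmf.expectation (cube_pmf n p) (\<lambda>x. \<phi> (mlpoly n c x))
     - measure_pmf.expectation (mixture_pmf (d + 1) \<gamma> (trunc_binomial_pmf n p cutoff)
           (profile_pmf n (d + 1) k (mlpoly n c))) \<phi>\<bar> \<le> (200 * R) ^ (4 * d) / sqrt W"
proof -
  define I where "I = {l\<in>{..n}. \<bar>\<sigma> l\<bar> \<le> cutoff}"
  define T where "T = {l\<in>{..n}. cutoff < \<bar>\<sigma> l\<bar>}"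
  define P where "P = (\<Sum>l\<in>I. bw l)"
  define \<psi> where "\<psi> = (\<lambda>x. \<phi> x - \<phi> 0)"
  define Y where "Y = (\<lambda>l \<pi>. \<Sum>i\<in>{1..d + 1}. \<gamma> l i * mlpoly n c (slice_point \<pi> (k i)))"
  define F where "F = (\<lambda>l. perm_avg n (\<lambda>\<pi>. \<psi> (mlpoly n c (slice_point \<pi> l))))"
  define H where "H = (\<lambda>l. perm_avg n (\<lambda>\<pi>. \<psi> (Y l \<pi>)))"
  define A where "A = (60 * R) ^ d"
  define t where "t = (\<lambda>l. 1 + \<bar>\<sigma> l\<bar>)"
  have W0: "W > 0" using W_ge'(2) by simp
  have A0: "0 \<le> A" using R_ge by (simp add: A_def)
  have t0: "0 \<le> t l" for l by (simp add: t_def)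
  have lip: "\<bar>\<psi> x - \<psi> y\<bar> \<le> \<bar>x - y\<bar>" for x y
    using lipschitz_onD[OF \<phi>, of x y] by (simp add: \<psi>_def dist_real_def)
  have psi: "\<bar>\<psi> x\<bar> \<le> \<bar>x\<bar>" for x
    using lip[of x 0] by (simp add: \<psi>_def)
  have split: "(\<Sum>l\<le>n. g l) = (\<Sum>l\<in>T. g l) + (\<Sum>l\<in>I. g l)" for g :: "nat \<Rightarrow> real"
  proof -
    have "{..n} = T \<union> I" "T \<inter> I = {}" "finite T" "finite I" by (auto simp: T_def I_def)
    thus ?thesis by (simp only: sum.union_disjoint)
  qed
  have subI: "(\<Sum>l\<in>I. bw l * t l ^ j) \<le> 18 * fact j" for j
  proof -
    have "(\<Sum>l\<in>I. bw l * t l ^ j) \<le> (\<Sum>l\<le>n. bw l * t l ^ j)"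
      by (intro sum_mono2 mult_nonneg_nonneg bw_nonneg zero_le_power t0) (auto simp: I_def)
    thus ?thesis using sigma_moment[of j] unfolding t_def by linarith
  qed
  have total: "(\<Sum>l\<in>T. bw l) + P = 1"
    using split[of bw] sum_bin_weight[of n p] by (simp add: P_def)
  have P_half: "1 / 2 \<le> P" using total tail_probability(2) by (simp add: T_def)
  have P_close: "1 - P \<le> 2 / sqrt W" using total tail_probability(1) by (simp add: T_def)
  have "0 \<le> (\<Sum>l\<in>T. bw l)" by (intro sum_nonneg bw_nonneg)
  hence P_le: "P \<le> 1" using total by linarith
  have P0: "0 < P" using P_half by linarith
  note trunc = trunc_binomial[OF p, of n cutoff, folded I_def, folded P_def, OF P0]

  have mix: "measure_pmf.expectation (mixture_pmf (d + 1) \<gamma> (trunc_binomial_pmf n p cutoff)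
           (profile_pmf n (d + 1) k (mlpoly n c))) \<phi> = \<phi> 0 + (\<Sum>l\<in>I. bw l / P * H l)"
  proof -
    have "measure_pmf.expectation (mixture_pmf (d + 1) \<gamma> (trunc_binomial_pmf n p cutoff)
           (profile_pmf n (d + 1) k (mlpoly n c))) \<phi>
        = (\<Sum>l\<in>I. pmf (trunc_binomial_pmf n p cutoff) l * perm_avg n (\<lambda>\<pi>. \<phi> (Y l \<pi>)))"
      unfolding Y_def by (rule mixture_expectation[OF _ trunc(1)]) (simp add: I_def)
    also have "\<dots> = (\<Sum>l\<in>I. bw l / P * \<phi> 0 + bw l / P * H l)"
    proof (intro sum.cong refl)
      fix l assume l: "l \<in> I"
      have "perm_avg n (\<lambda>\<pi>. \<phi> (Y l \<pi>)) = perm_avg n (\<lambda>\<pi>. \<phi> 0 + \<psi> (Y l \<pi>))"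
        by (simp add: \<psi>_def)
      also have "\<dots> = \<phi> 0 + H l" by (simp only: perm_avg_add perm_avg_const H_def)
      finally show "pmf (trunc_binomial_pmf n p cutoff) l * perm_avg n (\<lambda>\<pi>. \<phi> (Y l \<pi>))
          = bw l / P * \<phi> 0 + bw l / P * H l"
        unfolding trunc(2)[OF l] by (simp only: distrib_left)
    qed
    also have "\<dots> = (\<Sum>l\<in>I. bw l) / P * \<phi> 0 + (\<Sum>l\<in>I. bw l / P * H l)"
      by (simp add: sum.distrib sum_distrib_right sum_divide_distrib)
    also have "(\<Sum>l\<in>I. bw l) / P = 1" using P0 by (simp add: P_def)
    finally show ?thesis by simp
  qed
  have cube: "measure_pmf.expectation (cube_pmf n p) (\<lambda>x. \<phi> (mlpoly n c x)) = \<phi> 0 + (\<Sum>l\<le>n. bw l * F l)"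
  proof -
    have "perm_avg n (\<lambda>\<pi>. \<phi> (mlpoly n c (slice_point \<pi> l))) = \<phi> 0 + F l" for l
    proof -
      have "perm_avg n (\<lambda>\<pi>. \<phi> (mlpoly n c (slice_point \<pi> l))) = perm_avg n (\<lambda>\<pi>. \<phi> 0 + \<psi> (mlpoly n c (slice_point \<pi> l)))"
        by (simp add: \<psi>_def)
      thus ?thesis by (simp only: perm_avg_add perm_avg_const F_def)
    qed
    hence "measure_pmf.expectation (cube_pmf n p) (\<lambda>x. \<phi> (mlpoly n c x)) = (\<Sum>l\<le>n. bw l * (\<phi> 0 + F l))"
      unfolding cube_expectation[OF p] by presburger
    also have "\<dots> = (\<Sum>l\<le>n. bw l) * \<phi> 0 + (\<Sum>l\<le>n. bw l * F l)"
      by (simp add: distrib_left sum.distrib sum_distrib_right)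
    finally show ?thesis by (simp add: sum_bin_weight)
  qed

  have F_bound: "\<bar>F l\<bar> \<le> 2 * A * t l ^ d" if "l \<le> n" for l
  proof -
    have "\<bar>F l\<bar> \<le> perm_avg n (\<lambda>\<pi>. \<bar>mlpoly n c (slice_point \<pi> l)\<bar>)"
      unfolding F_def by (rule order.trans[OF perm_avg_abs perm_avg_mono[OF psi]])
    also have "\<dots> \<le> sqrt (Q c l)"
      unfolding cross_def power2_eq_square[symmetric] by (rule perm_avg_abs_le_sqrt)
    also have "\<dots> \<le> 2 * (60 * R * (1 + \<bar>\<sigma> l\<bar>)) ^ d"
      using norm_bound[OF c Q1 that] R_ge by (intro real_le_lsqrt) auto
    finally show ?thesis by (simp add: A_def t_def power_mult_distrib)
  qed
  have FH_bound: "\<bar>F l - H l\<bar> \<le> 6 * R * A * t l ^ (d + 1) / sqrt W" if l: "l \<in> I" for l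
  proof -
    have near: "near l" using l cutoff_near by (simp add: I_def near_def)
    have "F l - H l = perm_avg n (\<lambda>\<pi>. \<psi> (mlpoly n c (slice_point \<pi> l)) - \<psi> (Y l \<pi>))"
      by (simp only: F_def H_def perm_avg_diff)
    hence "\<bar>F l - H l\<bar> \<le> perm_avg n (\<lambda>\<pi>. \<bar>mlpoly n c (slice_point \<pi> l) - Y l \<pi>\<bar>)"
      by (simp only:) (rule order.trans[OF perm_avg_abs perm_avg_mono[OF lip]])
    also have "\<dots> \<le> 6 * R * A * t l ^ (d + 1) / sqrt W"
      unfolding Y_def A_def t_def by (rule interpolation_error[OF c Q1 near])
    finally show ?thesis .
  qed

  have tail: "\<bar>\<Sum>l\<in>T. bw l * F l\<bar> \<le> 108 * A * fact d / sqrt W"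
  proof -
    have "\<bar>\<Sum>l\<in>T. bw l * F l\<bar> \<le> (\<Sum>l\<in>T. bw l * (2 * A * t l ^ d))"
    proof (rule order.trans[OF sum_abs sum_mono])
      fix l assume "l \<in> T"
      thus "\<bar>bw l * F l\<bar> \<le> bw l * (2 * A * t l ^ d)"
        unfolding abs_mult using F_bound bw_nonneg[of l] by (simp add: T_def mult_left_mono)
    qed
    also have "\<dots> = 2 * A * (\<Sum>l\<in>T. bw l * t l ^ d)"
      unfolding sum_distrib_left by (intro sum.cong refl) (simp add: mult_ac)
    also have "\<dots> \<le> 2 * A * (54 * fact d / sqrt W)"
      unfolding T_def t_def using A0 by (intro mult_left_mono sigma_tail_moment) auto
    finally show ?thesis by simp
  qed
  have middle: "\<bar>\<Sum>l\<in>I. (bw l - bw l / P) * F l\<bar> \<le> 144 * A * fact d / sqrt W"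
  proof -
    have "\<bar>\<Sum>l\<in>I. (bw l - bw l / P) * F l\<bar> \<le> (\<Sum>l\<in>I. (4 / sqrt W) * (bw l * (2 * A * t l ^ d)))"
    proof (rule order.trans[OF sum_abs sum_mono])
      fix l assume l: "l \<in> I"
      have "\<bar>bw l - bw l / P\<bar> = bw l * ((1 - P) / P)"
      proof -
        have "bw l - bw l / P = - (bw l * ((1 - P) / P))" using P0 by (simp add: field_simps)
        moreover have "0 \<le> bw l * ((1 - P) / P)" using P0 P_le bw_nonneg by simp
        ultimately show ?thesis by linarith
      qed
      also have "\<dots> \<le> bw l * (4 / sqrt W)"
      proof (intro mult_left_mono bw_nonneg)
        have "(1 - P) / P \<le> (2 / sqrt W) / (1 / 2)"
          using P_close P_half P_le W0 by (intro frac_le) auto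
        thus "(1 - P) / P \<le> 4 / sqrt W" by simp
      qed
      finally have "\<bar>(bw l - bw l / P) * F l\<bar> \<le> (bw l * (4 / sqrt W)) * (2 * A * t l ^ d)"
        unfolding abs_mult using F_bound[of l] l W0 bw_nonneg[of l]
        by (intro mult_mono) (auto simp: I_def)
      thus "\<bar>(bw l - bw l / P) * F l\<bar> \<le> (4 / sqrt W) * (bw l * (2 * A * t l ^ d))"
        by (simp add: mult_ac)
    qed
    also have "\<dots> = (4 / sqrt W) * (2 * A) * (\<Sum>l\<in>I. bw l * t l ^ d)"
      unfolding sum_distrib_left by (intro sum.cong refl) (simp add: mult_ac)
    also have "\<dots> \<le> (4 / sqrt W) * (2 * A) * (18 * fact d)"
      using A0 W0 by (intro mult_left_mono subI) auto
    finally show ?thesis by simp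
  qed
  have main: "\<bar>\<Sum>l\<in>I. bw l / P * (F l - H l)\<bar> \<le> 216 * R * A * fact (d + 1) / sqrt W"
  proof -
    have "\<bar>\<Sum>l\<in>I. bw l / P * (F l - H l)\<bar> \<le> (\<Sum>l\<in>I. (2 * bw l) * (6 * R * A * t l ^ (d + 1) / sqrt W))"
    proof (rule order.trans[OF sum_abs sum_mono])
      fix l assume l: "l \<in> I"
      have "bw l / P \<le> bw l / (1 / 2)" using P_half P0 bw_nonneg by (intro divide_left_mono) auto
      hence "\<bar>bw l / P\<bar> \<le> 2 * bw l" using P0 bw_nonneg[of l] by simp
      thus "\<bar>bw l / P * (F l - H l)\<bar> \<le> (2 * bw l) * (6 * R * A * t l ^ (d + 1) / sqrt W)"
        unfolding abs_mult using FH_bound[OF l] bw_nonneg[of l] by (intro mult_mono) auto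
    qed
    also have "\<dots> = (12 * R * A / sqrt W) * (\<Sum>l\<in>I. bw l * t l ^ (d + 1))"
      unfolding sum_distrib_left by (intro sum.cong refl) (simp add: mult_ac)
    also have "\<dots> \<le> (12 * R * A / sqrt W) * (18 * fact (d + 1))"
      using A0 W0 R_ge by (intro mult_left_mono subI) auto
    finally show ?thesis by simp
  qed

  have "(\<Sum>l\<le>n. bw l * F l) - (\<Sum>l\<in>I. bw l / P * H l)
      = (\<Sum>l\<in>T. bw l * F l) + (\<Sum>l\<in>I. (bw l - bw l / P) * F l) + (\<Sum>l\<in>I. bw l / P * (F l - H l))"
  proof -
    have "(\<Sum>l\<in>I. (bw l - bw l / P) * F l) + (\<Sum>l\<in>I. bw l / P * (F l - H l))
        = (\<Sum>l\<in>I. bw l * F l - bw l / P * H l)"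
      unfolding sum.distrib[symmetric] left_diff_distrib right_diff_distrib
      by (intro sum.cong refl) simp
    thus ?thesis unfolding split by (simp only: sum_subtractf)
  qed
  hence "\<bar>measure_pmf.expectation (cube_pmf n p) (\<lambda>x. \<phi> (mlpoly n c x))
     - measure_pmf.expectation (mixture_pmf (d + 1) \<gamma> (trunc_binomial_pmf n p cutoff)
           (profile_pmf n (d + 1) k (mlpoly n c))) \<phi>\<bar>
     \<le> 108 * A * fact d / sqrt W + 144 * A * fact d / sqrt W + 216 * R * A * fact (d + 1) / sqrt W"
    unfolding mix cube using tail middle main by linarith
  also have "\<dots> = (252 * (1 * A * fact d) + 216 * (R * A * fact (d + 1))) / sqrt W"
    by (simp add: add_divide_distrib)
  also have "\<dots> \<le> (252 * (R * A * fact (d + 1)) + 216 * (R * A * fact (d + 1))) / sqrt W"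
    using W0 R_ge A0 by (intro divide_right_mono add_mono mult_left_mono mult_mono fact_mono) auto
  also have "\<dots> = 468 * R * (60 * R) ^ d * fact (d + 1) / sqrt W" by (simp add: A_def)
  also have "\<dots> \<le> (200 * R) ^ (4 * d) / sqrt W"
    using W0 by (intro divide_right_mono constants_bound) auto
  finally show ?thesis .
qed

lemma final_constant: "(200 * R) ^ (4 * d) \<le> (200 * (real d / (p * (1 - p))) * (M / \<eta>)) powr (200 * real d)"
proof -
  define b where "b = 200 * (real d / (p * (1 - p))) * (M / \<eta>)"
  have pp: "0 < p * (1 - p)" "p * (1 - p) \<le> 1" using p by (auto intro: mult_le_one)
  have "200 * R / 1 \<le> 200 * R / (p * (1 - p))"
    using pp R_ge by (intro divide_left_mono) auto
  moreover have "200 * R / (p * (1 - p)) = b" by (simp add: b_def R_def mult_ac)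
  ultimately have b: "200 * R \<le> b" by simp
  have b1: "1 \<le> b" using b R_ge by linarith
  have "(200 * R) ^ (4 * d) \<le> b ^ (4 * d)" using b R_ge by (intro power_mono) auto
  also have "\<dots> = b powr (real (4 * d))" using b1 by (subst powr_realpow) auto
  also have "\<dots> \<le> b powr (200 * real d)" using b1 by (intro powr_mono) auto
  finally show ?thesis by (simp only: b_def)
qed

lemma root_4: "root 4 (real n * p * (1 - p)) = sqrt W"
proof -
  have "root (2 * 2) (real n * p * (1 - p)) = root 2 (root 2 (real n * p * (1 - p)))"
    by (rule real_root_mult_exp)
  thus ?thesis unfolding W_def sqrt_def by simp
qed

end

theorem theorem6p17:
  shows "\<exists>K C :: real. K > 0 \<and> C > 0 \<and>
    (\<forall>(p :: real) (n :: nat) (d :: nat) (\<eta> :: real) (M :: real) (k :: nat \<Rightarrow> nat).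
       0 < p \<longrightarrow> p < 1 \<longrightarrow>
       1 \<le> d \<longrightarrow>
       real d \<le> K * sqrt (real n * p * (1 - p) / ln (real n * p * (1 - p))) \<longrightarrow>
       eta_M_system p n \<eta> M (d + 1) k \<longrightarrow>
       M \<le> sqrt (real n * p * (1 - p)) / (9 * real d) \<longrightarrow>
       (let s = sqrt (3 * ln (real n * p * (1 - p))) in
        \<exists>\<gamma> :: nat \<Rightarrow> nat \<Rightarrow> real.
          (\<forall>l\<le>n. \<bar>sigma_dev p n l\<bar> \<le> s \<longrightarrow>
             (\<forall>i\<in>{1..d + 1}. \<bar>\<gamma> l i\<bar> \<le> (C * (1 + \<bar>sigma_dev p n l\<bar>) * (M / \<eta>)) ^ d)) \<and>
          (\<forall>f :: real_mpoly.
             multilinear_poly f \<longrightarrow> in_variables {1..n} f \<longrightarrow> total_degree f = d \<longrightarrow>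
             (\<forall>i\<in>{1..d + 1}. l2_norm_pmf (slice_pmf n (k i)) (poly_eval f) \<le> 1) \<longrightarrow>
             (\<forall>\<phi> :: real \<Rightarrow> real. 1-lipschitz_on UNIV \<phi> \<longrightarrow>
                \<bar>measure_pmf.expectation (cube_pmf n p) (\<lambda>x. \<phi> (poly_eval f x))
                 - measure_pmf.expectation
                     (mixture_pmf (d + 1) \<gamma> (trunc_binomial_pmf n p s)
                       (profile_pmf n (d + 1) k (poly_eval f))) \<phi>\<bar>
                \<le> (C * (real d / (p * (1 - p))) * (M / \<eta>)) powr (C * real d)
                    * (1 / root 4 (real n * p * (1 - p)))))))"
proof (rule exI[of _ "1 :: real"], rule exI[of _ "200 :: real"], intro conjI allI impI)
  fix p :: real and n d :: nat and \<eta> M :: real and k :: "nat \<Rightarrow> nat"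
  assume "0 < p" "p < 1" "1 \<le> d" "eta_M_system p n \<eta> M (d + 1) k"
    "M \<le> sqrt (real n * p * (1 - p)) / (9 * real d)"
  then interpret slice_system p n d \<eta> M k by unfold_locales
  have s: "sqrt (3 * ln (real n * p * (1 - p))) = cutoff"
    by (simp only: cutoff_def W_sq)
  have gamma: "\<bar>\<gamma> l i\<bar> \<le> (200 * (1 + \<bar>\<sigma> l\<bar>) * (M / \<eta>)) ^ d" if "i \<in> {1..d + 1}" for l i
  proof (rule order.trans[OF gamma_bound[OF that]])
    have nonneg: "0 \<le> M / \<eta> * (1 + \<bar>\<sigma> l\<bar>)" using M eta by simp
    hence "M / \<eta> * (1 + \<bar>\<sigma> l\<bar>) \<le> 200 * (M / \<eta> * (1 + \<bar>\<sigma> l\<bar>))" by linarith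
    also have "\<dots> = 200 * (1 + \<bar>\<sigma> l\<bar>) * (M / \<eta>)" by (simp only: mult_ac)
    finally show "(M / \<eta> * (1 + \<bar>\<sigma> l\<bar>)) ^ d \<le> (200 * (1 + \<bar>\<sigma> l\<bar>) * (M / \<eta>)) ^ d"
      using nonneg by (rule power_mono)
  qed
  have main: "\<bar>measure_pmf.expectation (cube_pmf n p) (\<lambda>x. \<phi> (poly_eval f x))
       - measure_pmf.expectation (mixture_pmf (d + 1) \<gamma> (trunc_binomial_pmf n p cutoff)
             (profile_pmf n (d + 1) k (poly_eval f))) \<phi>\<bar>
      \<le> (200 * (real d / (p * (1 - p))) * (M / \<eta>)) powr (200 * real d) * (1 / root 4 (real n * p * (1 - p)))"
    if f: "multilinear_poly f" "in_variables {1..n} f" "total_degree f = d"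
      and norm: "\<forall>i\<in>{1..d + 1}. l2_norm_pmf (slice_pmf n (k i)) (poly_eval f) \<le> 1"
      and \<phi>: "1-lipschitz_on UNIV \<phi>"
    for f :: real_mpoly and \<phi> :: "real \<Rightarrow> real"
  proof -
    obtain c where c: "deg_less (Suc d) c" "poly_eval f = mlpoly n c"
      using poly_eval_eq_mlpoly[OF f] by metis
    have "Q c (k i) \<le> 1" if i: "i \<in> {1..d + 1}" for i
    proof -
      have "sqrt (Q c (k i)) \<le> 1"
        using bspec[OF norm i]
        unfolding l2_norm_pmf_def slice_expectation[OF k_le[OF i]] c(2) cross_def power2_eq_square .
      thus ?thesis by simp
    qed
    from lipschitz_expectation_bound[OF c(1) this \<phi>] show ?thesis
      unfolding c(2) root_4
    proof (rule order.trans)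
      show "(200 * R) ^ (4 * d) / sqrt W
          \<le> (200 * (real d / (p * (1 - p))) * (M / \<eta>)) powr (200 * real d) * (1 / sqrt W)"
        using final_constant W_ge'(2) by (simp add: divide_right_mono)
    qed
  qed
  show "let s = sqrt (3 * ln (real n * p * (1 - p))) in
        \<exists>\<gamma> :: nat \<Rightarrow> nat \<Rightarrow> real.
          (\<forall>l\<le>n. \<bar>sigma_dev p n l\<bar> \<le> s \<longrightarrow>
             (\<forall>i\<in>{1..d + 1}. \<bar>\<gamma> l i\<bar> \<le> (200 * (1 + \<bar>sigma_dev p n l\<bar>) * (M / \<eta>)) ^ d)) \<and>
          (\<forall>f :: real_mpoly.
             multilinear_poly f \<longrightarrow> in_variables {1..n} f \<longrightarrow> total_degree f = d \<longrightarrow>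
             (\<forall>i\<in>{1..d + 1}. l2_norm_pmf (slice_pmf n (k i)) (poly_eval f) \<le> 1) \<longrightarrow>
             (\<forall>\<phi> :: real \<Rightarrow> real. 1-lipschitz_on UNIV \<phi> \<longrightarrow>
                \<bar>measure_pmf.expectation (cube_pmf n p) (\<lambda>x. \<phi> (poly_eval f x))
                 - measure_pmf.expectation
                     (mixture_pmf (d + 1) \<gamma> (trunc_binomial_pmf n p s)
                       (profile_pmf n (d + 1) k (poly_eval f))) \<phi>\<bar>
                \<le> (200 * (real d / (p * (1 - p))) * (M / \<eta>)) powr (200 * real d)
                    * (1 / root 4 (real n * p * (1 - p)))))"
    unfolding Let_def s using gamma main by (intro exI[of _ \<gamma>]) blast
qed simp_all

end
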